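(* For all real $k$ and all $0<a,b<1$, $$\int_a^b\left(\frac{f(-q^{1/5})}{q^{1/5}f(-q^5)}\right)^{k} q^{-4/5}\,\frac{f(-q)^5}{f(-q^{1/5})}\,dq=-5\int_{y(a)}^{y(b)}\frac{x^{k-1}}{\sqrt{5+2x+x^2}}\,dx,$$ where $y(q)=\frac{1}{R(q)}-1-R(q)$.
   Context: For $0<q<1$, $f(-q)=\prod_{n\ge1}(1-q^n)$ and $R(q)$ is the Rogers–Ramanujan continued fraction $R(q)=\dfrac{q^{1/5}}{1+\dfrac{q}{1+\dfrac{q^2}{1+\dfrac{q^3}{1+\cdots}}}}$; all fractional powers of positive reals are the positive real ones. *)

theory Defs
  imports "HOL-Analysis.Analysis"
begin

text \<open>Ramanujan's function \<open>f\<close>, normalised so that \<open>ramanujan_f (- q)\<close> is the product of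
  \<open>1 - q ^ n\<close> over \<open>n \<ge> 1\<close>.\<close>
definition ramanujan_f :: "real \<Rightarrow> real" where
  "ramanujan_f x = (\<Prod>n. 1 - (- x) ^ Suc n)"

text \<open>\<open>rr_convergent q m n\<close> is the finite continued fraction
  \<open>q ^ n / (1 + q ^ (n + 1) / (1 + \<dots> / (1 + q ^ (n + m))))\<close>.\<close>
primrec rr_convergent :: "real \<Rightarrow> nat \<Rightarrow> nat \<Rightarrow> real" where
  "rr_convergent q 0 n = q ^ n"
| "rr_convergent q (Suc m) n = q ^ n / (1 + rr_convergent q m (Suc n))"

definition rogers_ramanujan :: "real \<Rightarrow> real" where
  "rogers_ramanujan q = q powr (1/5) * lim (\<lambda>m. rr_convergent q m 0)"

definition rr_y :: "real \<Rightarrow> real" where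
  "rr_y q = 1 / rogers_ramanujan q - 1 - rogers_ramanujan q"

end

theory Submission
  imports Defs "HOL-Real_Asymp.Real_Asymp"
begin

text \<open>
  Write \<open>f(-q)\<close> for the Euler product, let \<open>\<chi>\<close> be the odd character modulo 4, and put
  \<open>T\<^sub>r(x) = \<Sum> \<chi>(a) x^(a\<^sup>2)\<close> over the integers \<open>a \<equiv> r\<close> modulo 5 and \<open>K(x) = \<Sum> a \<chi>(a) x^(a\<^sup>2)\<close>
  over all integers. With \<open>x = q^(1/40)\<close>:

  \<^item> The functional equations of Rogers and Ramanujan (in the form given by Hardy and Wright, section
    19.14) give \<open>R(q) = T\<^sub>2(x) / T\<^sub>1(x)\<close>.
  \<^item> The Jacobi triple product gives \<open>T\<^sub>1(x) T\<^sub>2(x) = q^(1/4) f(-q) f(-q^5)\<close> and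
    \<open>K(q^(1/8)) = 2 q^(1/8) f(-q)\<^sup>3\<close>.
  \<^item> Multiplication by \<open>1 + 2\<i>\<close> in the Gaussian integers turns double sums in \<open>x\<close> into double sums in
    \<open>x^5\<close>, and yields \<open>T\<^sub>1(x) T\<^sub>2(x) = T\<^sub>1(x^5)\<^sup>2 - T\<^sub>1(x^5) T\<^sub>2(x^5) - T\<^sub>2(x^5)\<^sup>2\<close> and
    \<open>x (T\<^sub>2' T\<^sub>1 - T\<^sub>1' T\<^sub>2)(x) = 2 K(x^5)\<^sup>2\<close>.

  The quadratic identity at \<open>q^(1/5)\<close> becomes \<open>y(q) = f(-q^(1/5)) / (q^(1/5) f(-q^5))\<close>, and the
  Wronskian identity becomes \<open>q R'/R = f(-q)^5 / (5 f(-q^5))\<close>. Since \<open>5 + 2y + y\<^sup>2 = (1/R + R)\<^sup>2\<close>, the claim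
  is the substitution \<open>x = y(q)\<close>.
\<close>

section \<open>Sums over the integers\<close>

text \<open>The pairs n, -1 - n cover every integer exactly once, with no extra term for 0. An
  unordered sum over the integers thus becomes an ordinary series, to which the Weierstrass test and
  Tannery's theorem apply.\<close>

lemma has_sum_int_split:
  fixes f :: "int \<Rightarrow> real"
  assumes "summable (\<lambda>n. \<bar>f (int n)\<bar>)" "summable (\<lambda>n. \<bar>f (- 1 - int n)\<bar>)"
  shows "(f has_sum (\<Sum>n. f (int n) + f (- 1 - int n))) UNIV"
proof -
  note summable = assms[THEN summable_rabs_cancel]
  have 1: "(f has_sum (\<Sum>n. f (int n))) (range int)"
    using assms(1) summable(1) norm_summable_imp_has_sum[of "\<lambda>n. f (int n)"]
    by (subst has_sum_reindex) (auto simp: o_def)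
  have 2: "(f has_sum (\<Sum>n. f (- 1 - int n))) (range (\<lambda>n. - 1 - int n))"
    using assms(2) summable(2) norm_summable_imp_has_sum[of "\<lambda>n. f (- 1 - int n)"]
    by (subst has_sum_reindex) (auto simp: o_def inj_on_def)
  have "x \<in> range int \<union> range (\<lambda>n. - 1 - int n)" for x :: int
  proof (cases "x \<ge> 0")
    case True
    thus ?thesis by (auto intro!: rangeI[of _ "nat x"] image_eqI[of _ _ "nat x"])
  next
    case False
    thus ?thesis by (auto intro!: image_eqI[of _ _ "nat (- 1 - x)"])
  qed
  hence U: "range int \<union> range (\<lambda>n. - 1 - int n) = UNIV" by auto
  have "(f has_sum ((\<Sum>n. f (int n)) + (\<Sum>n. f (- 1 - int n)))) (range int \<union> range (\<lambda>n. - 1 - int n))"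
    by (intro has_sum_Un_disjoint 1 2) auto
  thus ?thesis
    unfolding U using summable by (simp add: suminf_add)
qed

text \<open>The weight leaves room for one differentiation: a coefficient bounded by
  \<open>1 + a^2\<close> picks up a factor \<open>a^2\<close>.\<close>

lemma summable_gaussian:
  fixes x :: real
  assumes "0 < x" "x < 1"
  shows "summable (\<lambda>n. (1 + (real n)\<^sup>2)\<^sup>2 * x powr (real n)\<^sup>2)"
proof (rule summable_comparison_test_bigo)
  show "summable (\<lambda>n. norm (1 / real n ^ 2))"
    using inverse_power_summable[of 2, where 'a = real] by (simp add: field_simps)
  show "(\<lambda>n. (1 + (real n)\<^sup>2)\<^sup>2 * x powr (real n)\<^sup>2) \<in> O(\<lambda>n. 1 / real n ^ 2)"
    using assms by real_asymp
qed

lemma summable_jacobi_nat: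
  fixes w p :: real
  assumes "0 < p" "p < 1" "w > 0"
  shows "summable (\<lambda>n. (1 + real n) * w powr real n * p powr (real n * (real n - 1) / 2))"
proof (rule summable_comparison_test_bigo)
  show "summable (\<lambda>n. norm (1 / real n ^ 2))"
    using inverse_power_summable[of 2, where 'a = real] by (simp add: field_simps)
  show "(\<lambda>n. (1 + real n) * w powr real n * p powr (real n * (real n - 1) / 2)) \<in> O(\<lambda>n. 1 / real n ^ 2)"
  \<comment> \<open>The growth of \<open>w powr n\<close> depends on the sign of ln w; in each case
    the Gaussian factor in \<open>p\<close> wins.\<close>
  proof (cases w "1 :: real" rule: linorder_cases)
    case less
    thus ?thesis using assms by real_asymp
  next
    case equal
    thus ?thesis using assms by simp real_asymp
  next
    case greater
    thus ?thesis using assms by real_asymp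
  qed
qed

text \<open>Unordered real sums converge absolutely, so Fubini applies to the double series.\<close>

lemma has_sum_product_real:
  fixes f :: "'a \<Rightarrow> real" and g :: "'b \<Rightarrow> real"
  assumes "(f has_sum S) UNIV" "(g has_sum T) UNIV"
  shows "((\<lambda>(a, b). f a * g b) has_sum (S * T)) UNIV"
proof -
  have f: "((\<lambda>a. \<bar>f a\<bar>) has_sum (\<Sum>\<^sub>\<infinity>a. \<bar>f a\<bar>)) UNIV" 
    and g: "((\<lambda>b. \<bar>g b\<bar>) has_sum (\<Sum>\<^sub>\<infinity>b. \<bar>g b\<bar>)) UNIV"
    using assms summable_on_iff_abs_summable_on_real[of f UNIV] summable_on_iff_abs_summable_on_real[of g UNIV]
    by (auto simp: has_sum_iff)
  have "(\<lambda>x. norm (case x of (a, b) \<Rightarrow> f a * g b)) summable_on (UNIV \<times> UNIV)"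
  proof (rule summable_on_SigmaI)
    show "((\<lambda>b. norm (case (a, b) of (a, b) \<Rightarrow> f a * g b)) has_sum (\<bar>f a\<bar> * (\<Sum>\<^sub>\<infinity>b. \<bar>g b\<bar>))) UNIV" for a
      using has_sum_cmult_right[OF g, of "\<bar>f a\<bar>"] by (simp add: abs_mult)
    show "(\<lambda>a. \<bar>f a\<bar> * (\<Sum>\<^sub>\<infinity>b. \<bar>g b\<bar>)) summable_on UNIV"
      using f by (intro summable_on_cmult_left) (auto simp: has_sum_iff)
  qed auto
  hence "(\<lambda>(a, b). f a * g b) summable_on (UNIV \<times> UNIV)"
    by (rule abs_summable_summable)
  thus ?thesis
    unfolding UNIV_Times_UNIV [symmetric]
    by (intro has_sum_SigmaI[where g = "\<lambda>a. f a * T"])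
       (auto intro!: has_sum_cmult_right has_sum_cmult_left assms)
qed

section \<open>Theta series over the Gaussian integers\<close>

definition theta :: "(int \<Rightarrow> real) \<Rightarrow> real \<Rightarrow> real" where
  "theta c x = (\<Sum>\<^sub>\<infinity>a. c a * x powr (real_of_int a)\<^sup>2)"

lemma theta_summable:
  fixes x :: real
  assumes "0 < x" "x < 1" "\<And>a. \<bar>c a\<bar> \<le> (1 + (real_of_int a)\<^sup>2)\<^sup>2"
  shows "summable (\<lambda>n. \<bar>c (int n) * x powr (real_of_int (int n))\<^sup>2\<bar>)"
    and "summable (\<lambda>n. \<bar>c (- 1 - int n) * x powr (real_of_int (- 1 - int n))\<^sup>2\<bar>)"
proof -
  have le: "\<bar>c a * x powr (real_of_int a)\<^sup>2\<bar> \<le> (1 + (real_of_int a)\<^sup>2)\<^sup>2 * x powr (real_of_int a)\<^sup>2" for a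
    using assms(3)[of a] by (simp add: abs_mult mult_right_mono)
  show "summable (\<lambda>n. \<bar>c (int n) * x powr (real_of_int (int n))\<^sup>2\<bar>)"
    by (rule summable_comparison_test'[OF summable_gaussian[OF assms(1,2)], of 0])
       (use le[of "int _"] in auto)
  have "summable (\<lambda>n. (1 + (real (Suc n))\<^sup>2)\<^sup>2 * x powr (real (Suc n))\<^sup>2)"
    using summable_gaussian[OF assms(1,2)] by (subst summable_Suc_iff)
  thus "summable (\<lambda>n. \<bar>c (- 1 - int n) * x powr (real_of_int (- 1 - int n))\<^sup>2\<bar>)"
  proof (rule summable_comparison_test')
    fix n :: nat
    have "(real_of_int (- 1 - int n))\<^sup>2 = (real (Suc n))\<^sup>2"
      by (simp add: power2_eq_square algebra_simps)
    thus "norm \<bar>c (- 1 - int n) * x powr (real_of_int (- 1 - int n))\<^sup>2\<bar>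
        \<le> (1 + (real (Suc n))\<^sup>2)\<^sup>2 * x powr (real (Suc n))\<^sup>2"
      using le[of "- 1 - int n"] by (simp only: real_norm_def abs_idempotent)
  qed
qed

lemma has_sum_theta:
  assumes "0 < x" "x < 1" "\<And>a. \<bar>c a\<bar> \<le> (1 + (real_of_int a)\<^sup>2)\<^sup>2"
  shows "((\<lambda>a. c a * x powr (real_of_int a)\<^sup>2) has_sum theta c x) UNIV"
  using has_sum_imp_summable[OF has_sum_int_split[OF theta_summable[OF assms]]]
  unfolding theta_def by simp

text \<open>Termwise differentiation: \<open>x d/dx\<close> multiplies the coefficient of
  \<open>x^(a^2)\<close> by \<open>a^2\<close>. The bound on \<open>c\<close> is one factor
  \<open>1 + a^2\<close> sharper than in \<open>has_sum_theta\<close>, so that the differentiated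
  coefficients still meet the bound there.\<close>

lemma has_real_derivative_theta:
  fixes x :: real
  assumes x: "0 < x" "x < 1" and c: "\<And>a. \<bar>c a\<bar> \<le> 1 + (real_of_int a)\<^sup>2"
  shows "(theta c has_real_derivative theta (\<lambda>a. (real_of_int a)\<^sup>2 * c a) x / x) (at x)"
proof -
  define f where "f = (\<lambda>n x. c (int n) * x powr (real_of_int (int n))\<^sup>2
    + c (- 1 - int n) * x powr (real_of_int (- 1 - int n))\<^sup>2)"
  define f' where "f' = (\<lambda>n x. ((real_of_int (int n))\<^sup>2 * c (int n) * x powr (real_of_int (int n))\<^sup>2
    + (real_of_int (- 1 - int n))\<^sup>2 * c (- 1 - int n) * x powr (real_of_int (- 1 - int n))\<^sup>2) / x)"
  have c1: "\<bar>c a\<bar> \<le> (1 + (real_of_int a)\<^sup>2)\<^sup>2" for a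
    using c[of a] by (smt (verit) one_le_power power2_eq_square self_le_power zero_le_power2 zero_less_numeral)
  have c2: "\<bar>(real_of_int a)\<^sup>2 * c a\<bar> \<le> (1 + (real_of_int a)\<^sup>2)\<^sup>2" for a
    using mult_mono[OF _ c[of a], of "(real_of_int a)\<^sup>2" "1 + (real_of_int a)\<^sup>2"]
    by (simp add: abs_mult power2_eq_square)
  have suminf: "theta c y = (\<Sum>n. f n y)" if "0 < y" "y < 1" for y
    using has_sum_unique[OF has_sum_theta[of y c] has_sum_int_split[OF theta_summable[of y c]]] that c1
    by (simp add: f_def)
  have suminf': "theta (\<lambda>a. (real_of_int a)\<^sup>2 * c a) y / y = (\<Sum>n. f' n y)" if "0 < y" "y < 1" for y
  proof -
    note s = theta_summable[of y "\<lambda>a. (real_of_int a)\<^sup>2 * c a", OF that c2]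
    show ?thesis
      using has_sum_unique[OF has_sum_theta[of y "\<lambda>a. (real_of_int a)\<^sup>2 * c a"] has_sum_int_split[OF s]] that c2
        suminf_divide[OF summable_add[OF s[THEN summable_rabs_cancel]], of y]
      by (simp add: f'_def)
  qed
  \<comment> \<open>On this interval the powers of \<open>y\<close> are largest at \<open>hi\<close>
    and \<open>1 / y\<close> is largest at \<open>lo\<close>, which gives a majorant uniform near
    \<open>x\<close>.\<close>
  define lo hi where "lo = x / 2" and "hi = (1 + x) / 2"
  have lh: "0 < lo" "lo < x" "x < hi" "hi < 1"
    using x by (auto simp: lo_def hi_def)
  have "((\<lambda>x. \<Sum>n. f n x) has_field_derivative (\<Sum>n. f' n x)) (at x)"
  proof (rule has_field_derivative_series')
    show "convex {lo..hi}" by simp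
    show "x \<in> {lo..hi}" using lh by simp
    show "x \<in> interior {lo..hi}" using lh by simp
    show "(f n has_field_derivative f' n y) (at y within {lo..hi})" if "y \<in> {lo..hi}" for n y
      unfolding f_def f'_def using that lh
      by (auto intro!: derivative_eq_intros simp: powr_diff field_simps)
    show "summable (\<lambda>n. f n x)"
      unfolding f_def using theta_summable[of x c, OF x c1]
      by (intro summable_add) (auto dest: summable_rabs_cancel)
    have M: "summable (\<lambda>n. (\<bar>(real_of_int (int n))\<^sup>2 * c (int n) * hi powr (real_of_int (int n))\<^sup>2\<bar>
      + \<bar>(real_of_int (- 1 - int n))\<^sup>2 * c (- 1 - int n) * hi powr (real_of_int (- 1 - int n))\<^sup>2\<bar>) / lo)"
      using lh x theta_summable[of hi "\<lambda>a. (real_of_int a)\<^sup>2 * c a", OF _ _ c2]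
      by (intro summable_divide summable_add) auto
    show "uniformly_convergent_on {lo..hi} (\<lambda>n y. \<Sum>i<n. f' i y)"
    proof (rule Weierstrass_m_test'[OF _ M])
      fix n y assume y: "y \<in> {lo..hi}"
      have *: "\<bar>d * y powr s\<^sup>2\<bar> \<le> \<bar>d * hi powr s\<^sup>2\<bar>" for d s :: real
        using y lh by (auto simp: abs_mult intro!: mult_left_mono powr_mono2)
      show "norm (f' n y) \<le> (\<bar>(real_of_int (int n))\<^sup>2 * c (int n) * hi powr (real_of_int (int n))\<^sup>2\<bar>
      + \<bar>(real_of_int (- 1 - int n))\<^sup>2 * c (- 1 - int n) * hi powr (real_of_int (- 1 - int n))\<^sup>2\<bar>) / lo"
        unfolding f'_def real_norm_def abs_divide
        using y lh by (intro frac_le order_trans[OF abs_triangle_ineq] add_mono * add_nonneg_nonneg) auto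
    qed
  qed
  hence "((\<lambda>x. \<Sum>n. f n x) has_real_derivative theta (\<lambda>a. (real_of_int a)\<^sup>2 * c a) x / x) (at x)"
    using x by (simp add: suminf')
  thus ?thesis
    by (rule has_field_derivative_transform_within_open[of _ _ _ "{0<..<1}"]) (use x suminf in auto)
qed

section \<open>The odd character modulo 4 and its classes modulo 5\<close>

definition chi4 :: "int \<Rightarrow> real" where
  "chi4 a = (if a mod 4 = 1 then 1 else if a mod 4 = 3 then - 1 else 0)"

lemma abs_chi4_le: "\<bar>chi4 a\<bar> \<le> 1"
  by (simp add: chi4_def)

lemma chi4_minus: "chi4 (- a) = - chi4 a"
proof -
  have "(- a) mod 4 = 1 \<longleftrightarrow> a mod 4 = 3" "(- a) mod 4 = 3 \<longleftrightarrow> a mod 4 = 1"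
    by presburger+
  thus ?thesis by (auto simp: chi4_def)
qed

text \<open>For odd \<open>a\<close> and \<open>b\<close>, 2a - b is congruent to b and a + 2b to a
  + 2 modulo 4, and adding 2 flips the sign of the character. If \<open>a\<close> or
  \<open>b\<close> is even, both sides vanish.\<close>

lemma chi4_rotation: "chi4 (2 * a - b) * chi4 (a + 2 * b) = - (chi4 a * chi4 b)"
proof -
  have cong: "chi4 m = chi4 n" if "m mod 4 = n mod 4" for m n
    using that by (simp add: chi4_def)
  define r s where "r = a mod 4" and "s = b mod 4"
  have "r = 0 \<or> r = 1 \<or> r = 2 \<or> r = 3" "s = 0 \<or> s = 1 \<or> s = 2 \<or> s = 3"
    unfolding r_def s_def by presburger+
  hence "chi4 (2 * r - s) * chi4 (r + 2 * s) = - (chi4 r * chi4 s)"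
    by (elim disjE) (simp_all add: chi4_def)
  moreover have "chi4 (2 * r - s) = chi4 (2 * a - b)" "chi4 (r + 2 * s) = chi4 (a + 2 * b)"
    unfolding r_def s_def by (rule cong, intro mod_diff_cong mod_add_cong mod_mult_cong; simp)+
  moreover have "chi4 r = chi4 a" "chi4 s = chi4 b"
    unfolding r_def s_def by (rule cong, simp)+
  ultimately show ?thesis by simp
qed

text \<open>The coefficients of \<open>T_r\<close>. Since \<open>mod\<close> returns values in 0..4,
  \<open>r\<close> has to be that representative of its class.\<close>

definition chi4_class :: "int \<Rightarrow> int \<Rightarrow> real" where
  "chi4_class r a = (if a mod 5 = r then chi4 a else 0)"

lemma abs_chi4_class_le: "\<bar>chi4_class r a\<bar> \<le> 1"
  by (simp add: chi4_class_def abs_chi4_le)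

text \<open>The character is odd and the exponent even, so the reflection a -> -a exchanges opposite
  classes with a change of sign.\<close>

lemma theta_chi4_class_minus:
  assumes "\<And>a. (- a) mod 5 = r \<longleftrightarrow> a mod 5 = s"
  shows "theta (chi4_class r) x = - theta (chi4_class s) x"
proof -
  have "theta (chi4_class r) x = (\<Sum>\<^sub>\<infinity>a. - (chi4_class s a * x powr (real_of_int a)\<^sup>2))"
    unfolding theta_def
    by (rule infsum_reindex_bij_witness[where i = uminus and j = uminus])
       (auto simp: chi4_class_def chi4_minus simp flip: assms)
  thus ?thesis by (simp add: theta_def infsum_uminus)
qed

text \<open>Class 0 is its own negative, 4 is opposite to 1 and 3 to 2; only \<open>T_1\<close> and
  \<open>T_2\<close> remain.\<close>

lemma theta_chi4_class:
  "theta (chi4_class 0) x = 0"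
  "theta (chi4_class 4) x = - theta (chi4_class 1) x"
  "theta (chi4_class 3) x = - theta (chi4_class 2) x"
proof -
  have "theta (chi4_class 0) x = - theta (chi4_class 0) x"
    by (rule theta_chi4_class_minus) presburger
  thus "theta (chi4_class 0) x = 0" by simp
qed (rule theta_chi4_class_minus, presburger)+

text \<open>The two coordinate systems on the sublattice \<open>Y \<equiv> 2 X\<close> modulo 5 are related by
  \<open>Y + \<i> X = (1 + 2 \<i>) (a - \<i> b)\<close>; this multiplies norms by 5.\<close>
lemma has_sum_rotation:
  fixes f :: "int \<times> int \<Rightarrow> real"
  shows "(f has_sum S) {(X, Y). X mod 5 = 2 \<and> Y mod 5 = 1}
    \<longleftrightarrow> ((\<lambda>(a, b). f (2 * a - b, a + 2 * b)) has_sum S) {(a, b). (a + 2 * b) mod 5 = 1}"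
proof -
  define h where "h = (\<lambda>(a :: int, b :: int). (2 * a - b, a + 2 * b))"
  have "h ` {(a, b). (a + 2 * b) mod 5 = 1} = {(X, Y). X mod 5 = 2 \<and> Y mod 5 = 1}"
  proof (intro equalityI subsetI)
    fix P assume "P \<in> h ` {(a, b). (a + 2 * b) mod 5 = 1}"
    then obtain a b where P: "P = (2 * a - b, a + 2 * b)" "(a + 2 * b) mod 5 = 1"
      by (auto simp: h_def)
    define c where "c = (a + 2 * b) div 5"
    have "a + 2 * b = 5 * c + 1" using P(2) by (simp add: c_def minus_mod_eq_mult_div [symmetric])
    hence "2 * a - b = 2 + 5 * (2 * c - b)" by simp
    hence "(2 * a - b) mod 5 = 2" by (simp only: mod_mult_self2) simp
    thus "P \<in> {(X, Y). X mod 5 = 2 \<and> Y mod 5 = 1}" using P by simp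
  next
    fix P :: "int \<times> int" assume "P \<in> {(X, Y). X mod 5 = 2 \<and> Y mod 5 = 1}"
    then obtain X Y where P: "P = (X, Y)" "X mod 5 = 2" "Y mod 5 = 1" by auto
    define m n where "m = X div 5" and "n = Y div 5"
    have "X = 5 * m + 2" "Y = 5 * n + 1"
      using P by (simp_all add: m_def n_def minus_mod_eq_mult_div [symmetric])
    \<comment> \<open>The witness solves X = 2a - b, Y = a + 2b: a = (2X + Y)/5 and b = (2Y - X)/5,
      which are integers because X is congruent to 2Y modulo 5.\<close>
    hence "P = h (2 * m + n + 1, 2 * n - m)" "(2 * m + n + 1) + 2 * (2 * n - m) = Y"
      using P(1) by (simp_all add: h_def)
    thus "P \<in> h ` {(a, b). (a + 2 * b) mod 5 = 1}"
      using P(3) by (intro image_eqI) auto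
  qed
  moreover have "inj h"
    by (auto simp: inj_def h_def)
  ultimately show ?thesis
    using has_sum_reindex[of h "{(a, b). (a + 2 * b) mod 5 = 1}" f S]
    by (simp add: inj_on_subset o_def h_def case_prod_unfold)
qed

text \<open>Multiplicativity of the Gaussian norm, with 5 the norm of 1 + 2i.\<close>

lemma powr_norm_rotation:
  fixes x a b :: real
  assumes "x > 0"
  shows "x powr (2 * a - b)\<^sup>2 * x powr (a + 2 * b)\<^sup>2 = (x ^ 5) powr a\<^sup>2 * (x ^ 5) powr b\<^sup>2"
proof -
  have x5: "x ^ 5 = x powr 5" using assms by simp
  show ?thesis
    unfolding x5 powr_powr powr_add [symmetric] by (simp add: power2_eq_square algebra_simps)
qed

text \<open>The weights 1, a and a^2 belong to \<open>T_r\<close>, to \<open>K\<close> and to the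
  derivative of \<open>T_r\<close> respectively.\<close>

lemma theta_weight_bound:
  assumes "\<And>a. \<bar>c a\<bar> \<le> 1"
  shows "\<bar>c a\<bar> \<le> (1 + (real_of_int a)\<^sup>2)\<^sup>2"
    and "\<bar>real_of_int a * c a\<bar> \<le> (1 + (real_of_int a)\<^sup>2)\<^sup>2"
    and "\<bar>(real_of_int a)\<^sup>2 * c a\<bar> \<le> (1 + (real_of_int a)\<^sup>2)\<^sup>2"
proof -
  define t where "t = \<bar>real_of_int a\<bar>"
  have t: "t \<ge> 0" "(real_of_int a)\<^sup>2 = t\<^sup>2" by (auto simp: t_def)
  have 1: "1 \<le> (1 + t\<^sup>2)\<^sup>2" by simp
  have "0 \<le> (t\<^sup>2)\<^sup>2" by simp
  hence 2: "t\<^sup>2 \<le> (1 + t\<^sup>2)\<^sup>2"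
    using zero_le_power2[of t] unfolding power2_sum by simp
  have "0 \<le> (1 - t)\<^sup>2" by simp
  hence 3: "t \<le> (1 + t\<^sup>2)\<^sup>2"
    using \<open>0 \<le> (t\<^sup>2)\<^sup>2\<close> zero_le_power2[of t] unfolding power2_sum power2_diff one_power2 by linarith
  show "\<bar>c a\<bar> \<le> (1 + (real_of_int a)\<^sup>2)\<^sup>2"
    using 1 assms[of a] unfolding t by linarith
  show "\<bar>real_of_int a * c a\<bar> \<le> (1 + (real_of_int a)\<^sup>2)\<^sup>2"
    using 3 mult_left_le[OF assms[of a] t(1)] unfolding t by (simp add: abs_mult t_def)
  show "\<bar>(real_of_int a)\<^sup>2 * c a\<bar> \<le> (1 + (real_of_int a)\<^sup>2)\<^sup>2"
    using 2 mult_left_le[OF assms[of a], of "t\<^sup>2"] unfolding t by (simp add: abs_mult)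
qed

text \<open>After the rotation the double sum for the left side runs over the line a + 2b = 1 modulo
  5. This line is a union of five product classes, and on each of them the sum at \<open>x^5\<close>
  factors again.\<close>

lemma theta_chi4_class_quadratic:
  fixes x :: real
  assumes x: "0 < x" "x < 1"
  defines "T \<equiv> \<lambda>r. theta (chi4_class r)"
  shows "T 2 x * T 1 x = (T 1 (x ^ 5))\<^sup>2 - T 1 (x ^ 5) * T 2 (x ^ 5) - (T 2 (x ^ 5))\<^sup>2"
proof -
  define y where "y = x ^ 5"
  have y: "0 < y" "y < 1" using x by (auto simp: y_def power_less_one_iff)
  have T: "((\<lambda>a. chi4_class r a * z powr (real_of_int a)\<^sup>2) has_sum T r z) UNIV"
    if "0 < z" "z < 1" for r z
    unfolding T_def by (intro has_sum_theta that theta_weight_bound abs_chi4_class_le)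
  define f where "f = (\<lambda>(X, Y). chi4 X * x powr (real_of_int X)\<^sup>2 * (chi4 Y * x powr (real_of_int Y)\<^sup>2))"
  have "((\<lambda>(X, Y). chi4_class 2 X * x powr (real_of_int X)\<^sup>2 * (chi4_class 1 Y * x powr (real_of_int Y)\<^sup>2))
      has_sum (T 2 x * T 1 x)) UNIV"
    by (intro has_sum_product_real T x)
  also have "?this \<longleftrightarrow> (f has_sum (T 2 x * T 1 x)) {(X, Y). X mod 5 = 2 \<and> Y mod 5 = 1}"
    by (rule has_sum_cong_neutral) (auto simp: f_def chi4_class_def split: if_splits)
  also have "\<dots> \<longleftrightarrow> ((\<lambda>(a, b). f (2 * a - b, a + 2 * b)) has_sum (T 2 x * T 1 x)) {(a, b). (a + 2 * b) mod 5 = 1}"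
    by (rule has_sum_rotation)
  finally have 1: "((\<lambda>(a, b). f (2 * a - b, a + 2 * b)) has_sum (T 2 x * T 1 x)) {(a, b). (a + 2 * b) mod 5 = 1}" .
  define g where "g = (\<lambda>r s (a, b). chi4_class r a * y powr (real_of_int a)\<^sup>2 * (chi4_class s b * y powr (real_of_int b)\<^sup>2))"
  have g: "(g r s has_sum (T r y * T s y)) UNIV" for r s
    unfolding g_def by (intro has_sum_product_real T y)
  \<comment> \<open>The index pairs (r, s) are the five solutions of r + 2s = 1 modulo 5; the minus
    sign is the one from \<open>chi4_rotation\<close>.\<close>
  have "((\<lambda>P. - (g 1 0 P + g 4 1 P + g 2 2 P + g 0 3 P + g 3 4 P)) has_sum
     - (T 1 y * T 0 y + T 4 y * T 1 y + T 2 y * T 2 y + T 0 y * T 3 y + T 3 y * T 4 y)) UNIV"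
    by (intro has_sum_uminusI has_sum_add g)
  also have "?this \<longleftrightarrow> ((\<lambda>(a, b). f (2 * a - b, a + 2 * b)) has_sum
     - (T 1 y * T 0 y + T 4 y * T 1 y + T 2 y * T 2 y + T 0 y * T 3 y + T 3 y * T 4 y)) {(a, b). (a + 2 * b) mod 5 = 1}"
  proof (rule has_sum_cong_neutral)
    fix P :: "int \<times> int"
    obtain a b where P: "P = (a, b)" by (cases P)
    have "f (2 * a - b, a + 2 * b) = chi4 (2 * a - b) * chi4 (a + 2 * b) *
        (x powr (2 * real_of_int a - real_of_int b)\<^sup>2 * x powr (real_of_int a + 2 * real_of_int b)\<^sup>2)"
      by (simp add: f_def)
    also have "\<dots> = - (chi4 a * y powr (real_of_int a)\<^sup>2 * (chi4 b * y powr (real_of_int b)\<^sup>2))"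
      unfolding powr_norm_rotation[OF x(1)] chi4_rotation y_def by simp
    finally have f: "f (2 * a - b, a + 2 * b) = \<dots>" .
    have g_sum: "g 1 0 P + g 4 1 P + g 2 2 P + g 0 3 P + g 3 4 P = (if (a + 2 * b) mod 5 = 1 then
        chi4 a * y powr (real_of_int a)\<^sup>2 * (chi4 b * y powr (real_of_int b)\<^sup>2) else 0)"
    proof -
      have m: "(a + 2 * b) mod 5 = (a mod 5 + 2 * (b mod 5)) mod 5"
        by (intro mod_add_cong mod_mult_cong; simp)
      have "a mod 5 = 0 \<or> a mod 5 = 1 \<or> a mod 5 = 2 \<or> a mod 5 = 3 \<or> a mod 5 = 4"
        "b mod 5 = 0 \<or> b mod 5 = 1 \<or> b mod 5 = 2 \<or> b mod 5 = 3 \<or> b mod 5 = 4"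
        by presburger+
      thus ?thesis
        unfolding P g_def chi4_class_def case_prod_conv m by (elim disjE) simp_all
    qed
    show "- (g 1 0 P + g 4 1 P + g 2 2 P + g 0 3 P + g 3 4 P) = (case P of (a, b) \<Rightarrow> f (2 * a - b, a + 2 * b))"
      if "P \<in> UNIV \<inter> {(a, b). (a + 2 * b) mod 5 = 1}"
      using that unfolding g_sum unfolding P by (simp add: f)
    show "- (g 1 0 P + g 4 1 P + g 2 2 P + g 0 3 P + g 3 4 P) = 0"
      if "P \<in> UNIV - {(a, b). (a + 2 * b) mod 5 = 1}"
      using that unfolding g_sum unfolding P by simp
  qed auto
  finally have "T 2 x * T 1 x = - (T 1 y * T 0 y + T 4 y * T 1 y + T 2 y * T 2 y + T 0 y * T 3 y + T 3 y * T 4 y)"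
    using 1 has_sum_unique by blast
  thus ?thesis
    unfolding T_def theta_chi4_class y_def by (simp add: power2_eq_square algebra_simps)
qed

text \<open>The sum over \<open>a + 2 b \<equiv> c\<close> is the same for all \<open>c \<noteq> 0\<close>, since rotation by 90 degrees maps
  class \<open>c\<close> to class \<open>2 c\<close>, and it vanishes for \<open>c = 0\<close>. So one class is a quarter of the full sum,
  which factors.\<close>
lemma theta_chi4_class_wronskian:
  fixes x :: real
  assumes x: "0 < x" "x < 1"
  defines "T \<equiv> \<lambda>r. theta (chi4_class r)"
    and "T' \<equiv> \<lambda>r. theta (\<lambda>a. (real_of_int a)\<^sup>2 * chi4_class r a)"
  shows "T' 2 x * T 1 x - T 2 x * T' 1 x = 2 * (theta (\<lambda>a. real_of_int a * chi4 a) (x ^ 5))\<^sup>2"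
proof -
  define y where "y = x ^ 5"
  have y: "0 < y" "y < 1" using x by (auto simp: y_def power_less_one_iff)
  define K where "K = theta (\<lambda>a. real_of_int a * chi4 a) y"
  have T: "((\<lambda>a. chi4_class r a * x powr (real_of_int a)\<^sup>2) has_sum T r x) UNIV"
    and T': "((\<lambda>a. (real_of_int a)\<^sup>2 * chi4_class r a * x powr (real_of_int a)\<^sup>2) has_sum T' r x) UNIV" for r
    unfolding T_def T'_def by (intro has_sum_theta x theta_weight_bound abs_chi4_class_le)+
  \<comment> \<open>The Wronskian is the double sum with weight X^2 - Y^2. In the rotated
    coordinates this weight is 3a^2 - 3b^2 - 8ab, the polynomial in \<open>h\<close>.\<close>
  define f where "f = (\<lambda>(X, Y). ((real_of_int X)\<^sup>2 - (real_of_int Y)\<^sup>2) *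
    (chi4 X * x powr (real_of_int X)\<^sup>2 * (chi4 Y * x powr (real_of_int Y)\<^sup>2)))"
  define h where "h = (\<lambda>(a, b). (3 * (real_of_int a)\<^sup>2 - 3 * (real_of_int b)\<^sup>2 - 8 * real_of_int a * real_of_int b) *
    (chi4 a * y powr (real_of_int a)\<^sup>2 * (chi4 b * y powr (real_of_int b)\<^sup>2)))"
  define C where "C = (\<lambda>c. {(a :: int, b). (a + 2 * b) mod 5 = c})"
  have fh: "f (2 * a - b, a + 2 * b) = - h (a, b)" for a b
  proof -
    have "f (2 * a - b, a + 2 * b) =
        ((2 * real_of_int a - real_of_int b)\<^sup>2 - (real_of_int a + 2 * real_of_int b)\<^sup>2) *
        (chi4 (2 * a - b) * chi4 (a + 2 * b)) *
        (x powr (2 * real_of_int a - real_of_int b)\<^sup>2 * x powr (real_of_int a + 2 * real_of_int b)\<^sup>2)"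
      by (simp add: f_def)
    also have "(2 * real_of_int a - real_of_int b)\<^sup>2 - (real_of_int a + 2 * real_of_int b)\<^sup>2 =
        3 * (real_of_int a)\<^sup>2 - 3 * (real_of_int b)\<^sup>2 - 8 * real_of_int a * real_of_int b"
      by (simp add: power2_eq_square algebra_simps)
    finally show ?thesis
      unfolding powr_norm_rotation[OF x(1)] chi4_rotation by (simp add: h_def y_def)
  qed
  have "((\<lambda>P. (case P of (X, Y) \<Rightarrow> (real_of_int X)\<^sup>2 * chi4_class 2 X * x powr (real_of_int X)\<^sup>2 * (chi4_class 1 Y * x powr (real_of_int Y)\<^sup>2))
       + - (case P of (X, Y) \<Rightarrow> chi4_class 2 X * x powr (real_of_int X)\<^sup>2 * ((real_of_int Y)\<^sup>2 * chi4_class 1 Y * x powr (real_of_int Y)\<^sup>2)))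
      has_sum (T' 2 x * T 1 x + - (T 2 x * T' 1 x))) UNIV"
    by (intro has_sum_add has_sum_uminusI has_sum_product_real T T')
  also have "?this \<longleftrightarrow> (f has_sum (T' 2 x * T 1 x + - (T 2 x * T' 1 x))) {(X, Y). X mod 5 = 2 \<and> Y mod 5 = 1}"
    by (rule has_sum_cong_neutral) (auto simp: f_def chi4_class_def left_diff_distrib split: if_splits)
  also have "\<dots> \<longleftrightarrow> ((\<lambda>(a, b). f (2 * a - b, a + 2 * b)) has_sum (T' 2 x * T 1 x + - (T 2 x * T' 1 x))) (C 1)"
    unfolding C_def by (rule has_sum_rotation)
  also have "(\<lambda>(a, b). f (2 * a - b, a + 2 * b)) = (\<lambda>P. - h P)"
    by (auto simp: fh)
  finally have "((\<lambda>P. - h P) has_sum (T' 2 x * T 1 x + - (T 2 x * T' 1 x))) (C 1)" .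
  from has_sum_uminusI[OF this] have C1: "infsum h (C 1) = - (T' 2 x * T 1 x - T 2 x * T' 1 x)"
    by (auto intro: infsumI)
  \<comment> \<open>The map (a, b) -> (-b, a) doubles a + 2b modulo 5. It changes the sign of both
    the polynomial and the character product in \<open>h\<close>, hence preserves \<open>h\<close>.
    Its inverse multiplies the class by -2, the inverse of 2 modulo 5.\<close>
  have rot1: "(2 * a - b) mod 5 = 2 * ((a + 2 * b) mod 5) mod 5" for a b :: int
  proof -
    have "2 * a - b = 2 * (a + 2 * b) + 5 * (- b)" by simp
    also have "\<dots> mod 5 = 2 * (a + 2 * b) mod 5" by (rule mod_mult_self2)
    finally show ?thesis by (simp only: mod_mult_right_eq)
  qed
  have rot2: "(b - 2 * a) mod 5 = - 2 * ((a + 2 * b) mod 5) mod 5" for a b :: int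
  proof -
    have "b - 2 * a = - 2 * (a + 2 * b) + 5 * b" by simp
    also have "\<dots> mod 5 = - 2 * (a + 2 * b) mod 5" by (rule mod_mult_self2)
    finally show ?thesis by (simp only: mod_mult_right_eq)
  qed
  have rot: "infsum h (C c) = infsum h (C d)" if "d = 2 * c mod 5" "c = - 2 * d mod 5" for c d
  proof (rule infsum_reindex_bij_witness[where i = "\<lambda>(a, b). (b, - a)" and j = "\<lambda>(a, b). (- b, a)"])
    fix P assume "P \<in> C c"
    then obtain a b where P: "P = (a, b)" "(a + 2 * b) mod 5 = c" by (auto simp: C_def)
    have "(2 * a - b) mod 5 = d" unfolding rot1 P(2) that(1) ..
    thus "(\<lambda>(a, b). (- b, a)) P \<in> C d"
      unfolding P C_def by simp
    show "h ((\<lambda>(a, b). (- b, a)) P) = h P"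
      unfolding P h_def by (simp add: chi4_minus algebra_simps)
  next
    fix P assume "P \<in> C d"
    then obtain a b where P: "P = (a, b)" "(a + 2 * b) mod 5 = d" by (auto simp: C_def)
    have "(b - 2 * a) mod 5 = c" unfolding rot2 P(2) by (rule that(2) [symmetric])
    thus "(\<lambda>(a, b). (b, - a)) P \<in> C c"
      unfolding P C_def by simp
  qed auto
  \<comment> \<open>Repeated doubling visits all nonzero classes: 1, 2, 4, 3.\<close>
  have rots: "infsum h (C 1) = infsum h (C 2)" "infsum h (C 2) = infsum h (C 4)" "infsum h (C 4) = infsum h (C 3)"
    by (rule rot; simp)+
  have C0: "infsum h (C 0) = 0"
  proof -
    \<comment> \<open>The lattice a + 2b = 0 modulo 5 is parametrised by a second rotation. It
      reduces the polynomial to 25(a^2 - b^2), which is antisymmetric under swapping the coordinates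
      while the other factors are symmetric, so the sum equals its own negative.\<close>
    define k where "k = (\<lambda>(a, b). h (2 * a + b, 2 * b - a))"
    have k_eq: "k (a, b) = - 25 * ((real_of_int a)\<^sup>2 - (real_of_int b)\<^sup>2) *
        (chi4 a * chi4 b * ((y ^ 5) powr (real_of_int a)\<^sup>2 * (y ^ 5) powr (real_of_int b)\<^sup>2))" for a b
    proof -
      have "k (a, b) = (3 * (2 * real_of_int a + real_of_int b)\<^sup>2 - 3 * (2 * real_of_int b - real_of_int a)\<^sup>2
           - 8 * (2 * real_of_int a + real_of_int b) * (2 * real_of_int b - real_of_int a)) *
          (chi4 (2 * b - a) * chi4 (b + 2 * a)) *
          (y powr (2 * real_of_int b - real_of_int a)\<^sup>2 * y powr (real_of_int b + 2 * real_of_int a)\<^sup>2)"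
        by (simp add: k_def h_def add.commute)
      also have "3 * (2 * real_of_int a + real_of_int b)\<^sup>2 - 3 * (2 * real_of_int b - real_of_int a)\<^sup>2
           - 8 * (2 * real_of_int a + real_of_int b) * (2 * real_of_int b - real_of_int a) =
           25 * ((real_of_int a)\<^sup>2 - (real_of_int b)\<^sup>2)"
        by (simp add: power2_eq_square algebra_simps)
      finally show ?thesis
        unfolding powr_norm_rotation[OF y(1)] chi4_rotation by (simp add: algebra_simps)
    qed
    have k: "k (b, a) = - k (a, b)" for a b
      unfolding k_eq[of a b] k_eq[of b a] by (simp add: algebra_simps)
    have 1: "infsum h (C 0) = infsum k UNIV"
    proof -
      have "C 0 = range (\<lambda>(a, b). (2 * a + b, 2 * b - a))"
      proof (intro equalityI subsetI)
        fix P assume "P \<in> C 0"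
        then obtain a b where P: "P = (a, b)" "(a + 2 * b) mod 5 = 0" by (auto simp: C_def)
        define n where "n = (a + 2 * b) div 5"
        have "a + 2 * b = 5 * n" using P(2) by (simp add: n_def minus_mod_eq_mult_div [symmetric])
        \<comment> \<open>Solving 2a' + b' = a and 2b' - a' = b gives b' = (a + 2b)/5 = n and a' =
          2n - b.\<close>
        thus "P \<in> range (\<lambda>(a, b). (2 * a + b, 2 * b - a))"
          unfolding P(1) by (intro image_eqI[where x = "(2 * n - b, n)"]) auto
      next
        fix P assume "P \<in> range (\<lambda>(a :: int, b). (2 * a + b, 2 * b - a))"
        then obtain a b where P: "P = (2 * a + b, 2 * b - a)" by auto
        have "(2 * a + b) + 2 * (2 * b - a) = 5 * b" by simp
        thus "P \<in> C 0" unfolding P C_def by simp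
      qed
      moreover have "inj (\<lambda>(a :: int, b :: int). (2 * a + b, 2 * b - a))"
        by (auto simp: inj_def)
      ultimately show ?thesis
        by (simp add: infsum_reindex k_def o_def case_prod_unfold)
    qed
    also have "\<dots> = (\<Sum>\<^sub>\<infinity>P. - k P)"
    proof (rule infsum_reindex_bij_witness[where i = "\<lambda>(a, b). (b, a)" and j = "\<lambda>(a, b). (b, a)"])
      show "- k (case P of (a, b) \<Rightarrow> (b, a)) = k P" for P
        using k[of "snd P" "fst P"] by (simp add: case_prod_unfold)
    qed auto
    also have "\<dots> = - infsum k UNIV" by (rule infsum_uminus)
    finally show ?thesis using 1 by simp
  qed
  define A B where "A = theta chi4 y" and "B = theta (\<lambda>a. (real_of_int a)\<^sup>2 * chi4 a) y"
  have A: "((\<lambda>a. chi4 a * y powr (real_of_int a)\<^sup>2) has_sum A) UNIV"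
    and B: "((\<lambda>a. (real_of_int a)\<^sup>2 * chi4 a * y powr (real_of_int a)\<^sup>2) has_sum B) UNIV"
    and K: "((\<lambda>a. real_of_int a * chi4 a * y powr (real_of_int a)\<^sup>2) has_sum K) UNIV"
    unfolding A_def B_def K_def by (intro has_sum_theta y theta_weight_bound abs_chi4_le)+
  \<comment> \<open>In the full sum the parts with a^2 and b^2 both equal 3AB and cancel; only the
    mixed term survives.\<close>
  have "((\<lambda>P. 3 * (case P of (a, b) \<Rightarrow> (real_of_int a)\<^sup>2 * chi4 a * y powr (real_of_int a)\<^sup>2 * (chi4 b * y powr (real_of_int b)\<^sup>2))
      + - (3 * (case P of (a, b) \<Rightarrow> chi4 a * y powr (real_of_int a)\<^sup>2 * ((real_of_int b)\<^sup>2 * chi4 b * y powr (real_of_int b)\<^sup>2)))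
      + - (8 * (case P of (a, b) \<Rightarrow> real_of_int a * chi4 a * y powr (real_of_int a)\<^sup>2 *
          (real_of_int b * chi4 b * y powr (real_of_int b)\<^sup>2)))) has_sum
     (3 * (B * A) + - (3 * (A * B)) + - (8 * (K * K)))) UNIV" (is "(?h has_sum _) _")
    by (intro has_sum_add has_sum_uminusI has_sum_cmult_right has_sum_product_real A B K)
  also have "?h = h"
    by (intro ext) (simp add: h_def case_prod_unfold algebra_simps)
  finally have h: "(h has_sum - 8 * K\<^sup>2) UNIV"
    by (simp add: power2_eq_square)
  \<comment> \<open>Class 0 contributes nothing and the other four agree with \<open>C 1\<close>,
    whose sum is minus the Wronskian W; hence -8 K^2 = -4 W.\<close>
  have "- 8 * K\<^sup>2 = infsum h (\<Union>c\<in>{0,1,2,3,4}. C c)"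
  proof -
    have "P \<in> (\<Union>c\<in>{0,1,2,3,4}. C c)" for P
    proof -
      have "n mod 5 = 0 \<or> n mod 5 = 1 \<or> n mod 5 = 2 \<or> n mod 5 = 3 \<or> n mod 5 = 4" for n :: int
        by presburger
      thus ?thesis by (cases P) (simp add: C_def)
    qed
    hence "(\<Union>c\<in>{0,1,2,3,4}. C c) = UNIV" by blast
    thus ?thesis using infsumI[OF h] by simp
  qed
  also have "\<dots> = (\<Sum>c\<in>{0,1,2,3,4}. infsum h (C c))"
    using has_sum_imp_summable[OF h]
    by (intro sum_infsum [symmetric]) (auto simp: C_def intro: summable_on_subset_banach)
  also have "\<dots> = - 4 * (T' 2 x * T 1 x - T 2 x * T' 1 x)"
    using rots by (simp add: C0 C1)
  finally show ?thesis
    by (simp add: K_def y_def)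
qed

section \<open>The Jacobi triple product\<close>

text \<open>The partial products decrease, so the limit bounds all of them from below; its
  positivity later makes their reciprocals uniformly bounded.\<close>

lemma euler_product:
  fixes p :: real
  assumes p: "0 < p" "p < 1"
  shows euler_product_LIMSEQ: "(\<lambda>N. \<Prod>i<N. 1 - p ^ Suc i) \<longlonglongrightarrow> ramanujan_f (- p)"
    and ramanujan_f_pos: "ramanujan_f (- p) > 0"
    and ramanujan_f_le: "ramanujan_f (- p) \<le> (\<Prod>i<N. 1 - p ^ Suc i)"
proof -
  have eq: "ramanujan_f (- p) = (\<Prod>i. 1 - p ^ Suc i)"
    by (simp add: ramanujan_f_def)
  have less: "p ^ Suc i < 1" for i
    using p by (intro power_Suc_less_one) auto
  have "summable (\<lambda>i. p ^ Suc i)"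
    using p by (subst summable_Suc_iff) (auto intro: summable_geometric)
  hence "abs_convergent_prod (\<lambda>i. 1 - p ^ Suc i)"
    using p by (intro summable_imp_abs_convergent_prod) simp
  hence conv: "convergent_prod (\<lambda>i. 1 - p ^ Suc i)"
    by (rule abs_convergent_prod_imp_convergent_prod)
  show lim: "(\<lambda>N. \<Prod>i<N. 1 - p ^ Suc i) \<longlonglongrightarrow> ramanujan_f (- p)"
    using convergent_prod_LIMSEQ[OF conv] unfolding eq
    by (subst filterlim_sequentially_Suc [symmetric]) (simp only: lessThan_Suc_atMost)
  have dec: "decseq (\<lambda>N. \<Prod>i<N. 1 - p ^ Suc i)"
  proof (rule decseq_SucI)
    fix N
    have "(\<Prod>i<N. 1 - p ^ Suc i) * (1 - p ^ Suc N) \<le> (\<Prod>i<N. 1 - p ^ Suc i) * 1"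
      using less p by (intro mult_left_mono prod_nonneg) (auto simp: less_imp_le)
    thus "(\<Prod>i<Suc N. 1 - p ^ Suc i) \<le> (\<Prod>i<N. 1 - p ^ Suc i)" by simp
  qed
  show "ramanujan_f (- p) \<le> (\<Prod>i<N. 1 - p ^ Suc i)" for N
    by (rule decseq_ge[OF dec lim])
  have "ramanujan_f (- p) \<ge> 0"
    using less by (intro LIMSEQ_le_const[OF lim] exI[of _ 0] allI impI prod_nonneg) (auto simp: less_imp_le)
  moreover have "ramanujan_f (- p) \<noteq> 0"
    unfolding eq using less by (intro prodinf_nonzero conv) (auto simp: less_le)
  ultimately show "ramanujan_f (- p) > 0" by simp
qed

section \<open>Coefficients of the finite triple product\<close>

definition qfact_inv :: "real \<Rightarrow> int \<Rightarrow> real" where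
  "qfact_inv p m = (if m < 0 then 0 else 1 / (\<Prod>i<nat m. 1 - p ^ Suc i))"

text \<open>At m = 0 the factor on the right vanishes: extending the reciprocal of (p; p)_m by zero
  to negative \<open>m\<close> is the extension that keeps this recurrence valid everywhere.\<close>

lemma qfact_inv_minus1:
  assumes p: "0 < p" "p < 1"
  shows "qfact_inv p (m - 1) = (1 - p powr real_of_int m) * qfact_inv p m"
proof (cases "m > 0")
  case True
  then obtain n where n: "m = int (Suc n)"
    by (metis gr0_conv_Suc zero_less_imp_eq_int)
  have "p ^ Suc n < 1"
    using p by (intro power_Suc_less_one) auto
  moreover have "p powr real_of_int m = p ^ Suc n"
    unfolding n using powr_realpow[OF p(1), of "Suc n"] by simp
  moreover have "m - 1 = int n" by (simp add: n)
  ultimately show ?thesis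
    by (simp add: qfact_inv_def n nat_add_distrib del: power_Suc)
next
  case False
  thus ?thesis using p by (cases "m = 0") (auto simp: qfact_inv_def)
qed

lemma qfact_inv_bound:
  assumes p: "0 < p" "p < 1"
  shows "0 \<le> qfact_inv p m" "qfact_inv p m \<le> 1 / ramanujan_f (- p)"
  using ramanujan_f_pos[OF p] ramanujan_f_le[OF p, of "nat m"]
  by (auto simp: qfact_inv_def frac_le)

lemma qfact_inv_LIMSEQ:
  assumes p: "0 < p" "p < 1" and g: "filterlim (\<lambda>N. nat (g N)) at_top sequentially"
  shows "(\<lambda>N. qfact_inv p (g N)) \<longlonglongrightarrow> 1 / ramanujan_f (- p)"
proof -
  have "(\<lambda>N. 1 / (\<Prod>i<nat (g N). 1 - p ^ Suc i)) \<longlonglongrightarrow> 1 / ramanujan_f (- p)"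
    using ramanujan_f_pos[OF p]
    by (intro tendsto_intros filterlim_compose[OF euler_product_LIMSEQ[OF p] g]) auto
  moreover have "\<forall>\<^sub>F N in sequentially. nat (g N) \<ge> 1"
    using g by (simp add: filterlim_at_top)
  hence "\<forall>\<^sub>F N in sequentially. 1 / (\<Prod>i<nat (g N). 1 - p ^ Suc i) = qfact_inv p (g N)"
    by eventually_elim (auto simp: qfact_inv_def)
  ultimately show ?thesis by (rule Lim_transform_eventually)
qed

text \<open>With \<open>qfact_inv\<close> vanishing on negative arguments, the following are the coefficients of the
  finite triple product; they are zero for \<open>\<bar>k\<bar> > N\<close>, and no boundary cases arise in the recurrence.\<close>
definition jacobi_coeff :: "real \<Rightarrow> nat \<Rightarrow> int \<Rightarrow> real" where
  "jacobi_coeff p N k = (\<Prod>i<2 * N. 1 - p ^ Suc i) * qfact_inv p (int N - k) * qfact_inv p (int N + k)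
     * p powr (real_of_int k * (real_of_int k - 1) / 2)"

lemma jacobi_coeff_0: "jacobi_coeff p 0 k = (if k = 0 then p powr 0 else 0)"
  by (auto simp: jacobi_coeff_def qfact_inv_def)

text \<open>The new factor (1 + w p^N)(1 + p^(N+1)/w) equals (1 + p^(2N+1)) + p^N w + p^(N+1)/w; the
  recurrence compares coefficients of w^k.\<close>

lemma jacobi_coeff_Suc:
  assumes p: "0 < p" "p < 1"
  shows "jacobi_coeff p (Suc N) k = (1 + p ^ (2 * N + 1)) * jacobi_coeff p N k
    + p ^ N * jacobi_coeff p N (k - 1) + p ^ (N + 1) * jacobi_coeff p N (k + 1)"
proof -
  define M K E where "M = p ^ N" and "K = p powr real_of_int k"
    and "E = p powr (real_of_int k * (real_of_int k - 1) / 2)"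
  define Q G H where "Q = (\<Prod>i<2 * N. 1 - p ^ Suc i)" and "G = qfact_inv p (int (Suc N) - k)"
    and "H = qfact_inv p (int (Suc N) + k)"
  note minus1 = qfact_inv_minus1[OF p]
  have K: "K > 0" using p by (simp add: K_def)
  have M: "M = p powr real N" using p by (simp add: M_def powr_realpow)
  have e: "p powr (real N + 1 - real_of_int k) = p * M / K" "p powr (real N + 1 + real_of_int k) = p * M * K"
     "p powr (real N - real_of_int k) = M / K" "p powr (real N + real_of_int k) = M * K"
    using p by (simp_all add: M K_def powr_add powr_diff)
  have G: "qfact_inv p (int N - k) = (1 - p * M / K) * G"
    using minus1[of "int (Suc N) - k"] by (simp add: G_def e [symmetric] add.commute diff_diff_eq2 diff_add_eq)
  have G': "qfact_inv p (int N - (k + 1)) = (1 - M / K) * (1 - p * M / K) * G"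
    using minus1[of "int N - k"] G by (simp add: e [symmetric] diff_diff_eq)
  have H: "qfact_inv p (int N + k) = (1 - p * M * K) * H"
    using minus1[of "int (Suc N) + k"] by (simp add: H_def e [symmetric] add.commute add.left_commute)
  have H': "qfact_inv p (int N + (k - 1)) = (1 - M * K) * (1 - p * M * K) * H"
    using minus1[of "int N + k"] H by (simp add: e [symmetric] add_diff_eq)
  have "p powr (real_of_int (k - 1) * (real_of_int (k - 1) - 1) / 2)
      = p powr (real_of_int k * (real_of_int k - 1) / 2 + 1 - real_of_int k)"
    by (intro arg_cong[of _ _ "\<lambda>t. p powr t"]) (simp add: field_simps)
  hence E': "p powr (real_of_int (k - 1) * (real_of_int (k - 1) - 1) / 2) = E * p / K"
    using p by (simp add: E_def K_def powr_add powr_diff)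
  have "p powr (real_of_int (k + 1) * (real_of_int (k + 1) - 1) / 2)
      = p powr (real_of_int k * (real_of_int k - 1) / 2 + real_of_int k)"
    by (intro arg_cong[of _ _ "\<lambda>t. p powr t"]) (simp add: field_simps)
  hence E'': "p powr (real_of_int (k + 1) * (real_of_int (k + 1) - 1) / 2) = E * K"
    using p by (simp add: E_def K_def powr_add)
  \<comment> \<open>With the common factor \<open>R\<close> split off, the recurrence is the
    rational identity X0 = (1 + p M^2) X1 + X2 + X3 in \<open>p\<close>, \<open>M\<close> and
    \<open>K\<close>.\<close>
  define R X0 X1 X2 X3 where "R = Q * G * H * E"
    and "X0 = (1 - p * M\<^sup>2) * (1 - p\<^sup>2 * M\<^sup>2)" and "X1 = (1 - p * M / K) * (1 - p * M * K)"
    and "X2 = p * M / K * ((1 - M * K) * (1 - p * M * K))" and "X3 = p * M * K * ((1 - M / K) * (1 - p * M / K))"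
  note X_defs = R_def X0_def X1_def X2_def X3_def
  have "jacobi_coeff p (Suc N) k = R * X0"
    by (simp add: X_defs jacobi_coeff_def Q_def G_def H_def E_def M_def power_mult [symmetric] power2_eq_square mult_2 power_add)
  moreover have "jacobi_coeff p N k = R * X1"
    unfolding jacobi_coeff_def Q_def [symmetric] E_def [symmetric] G H by (simp add: X_defs)
  moreover have "p ^ N * jacobi_coeff p N (k - 1) = R * X2"
  proof -
    have "jacobi_coeff p N (k - 1) = Q * G * ((1 - M * K) * (1 - p * M * K) * H) * (E * p / K)"
      unfolding jacobi_coeff_def Q_def [symmetric] H' E' by (simp add: G_def diff_diff_eq2 add.commute)
    thus ?thesis unfolding M_def [symmetric] by (simp add: X_defs)
  qed
  moreover have "p ^ (N + 1) * jacobi_coeff p N (k + 1) = R * X3"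
  proof -
    have "jacobi_coeff p N (k + 1) = Q * ((1 - M / K) * (1 - p * M / K) * G) * H * (E * K)"
      unfolding jacobi_coeff_def Q_def [symmetric] G' E'' by (simp add: H_def add.commute add.left_commute)
    moreover have "p ^ (N + 1) = p * M" by (simp add: M_def)
    ultimately show ?thesis by (simp only: X_defs) (simp add: mult_ac)
  qed
  moreover have "p ^ (2 * N + 1) = p * M\<^sup>2"
    by (simp add: M_def power_mult [symmetric] mult.commute)
  moreover have "X0 = (1 + p * M\<^sup>2) * X1 + X2 + X3"
    using K unfolding X_defs by (simp add: field_simps power2_eq_square)
  ultimately show ?thesis by (simp only: distrib_left distrib_right mult_ac mult_1_left)
qed

text \<open>The weight \<open>u\<close> is arbitrary because the recurrence is needed twice: with
  \<open>w powi k\<close> for the triple product and with \<open>k * (- 1) powi k\<close> for the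
  cube identity.\<close>

lemma has_sum_jacobi_coeff_Suc:
  assumes p: "0 < p" "p < 1"
    and A: "((\<lambda>k. jacobi_coeff p N k * u k) has_sum A) UNIV"
    and B: "((\<lambda>k. jacobi_coeff p N k * u (k + 1)) has_sum B) UNIV"
    and C: "((\<lambda>k. jacobi_coeff p N k * u (k - 1)) has_sum C) UNIV"
  shows "((\<lambda>k. jacobi_coeff p (Suc N) k * u k) has_sum
      ((1 + p ^ (2 * N + 1)) * A + p ^ N * B + p ^ (N + 1) * C)) UNIV"
proof -
  have shift: "bij (\<lambda>k :: int. k + m)" for m
    by (rule bij_betwI[of _ _ _ "\<lambda>k. k - m"]) auto
  have B': "((\<lambda>k. jacobi_coeff p N (k - 1) * u k) has_sum B) UNIV"
    using B has_sum_reindex_bij_betw[OF shift[of "-1"], of "\<lambda>k. jacobi_coeff p N k * u (k + 1)" B] by simp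
  have C': "((\<lambda>k. jacobi_coeff p N (k + 1) * u k) has_sum C) UNIV"
    using C has_sum_reindex_bij_betw[OF shift[of 1], of "\<lambda>k. jacobi_coeff p N k * u (k - 1)" C] by simp
  have "((\<lambda>k. (1 + p ^ (2 * N + 1)) * (jacobi_coeff p N k * u k)
      + p ^ N * (jacobi_coeff p N (k - 1) * u k) + p ^ (N + 1) * (jacobi_coeff p N (k + 1) * u k)) has_sum
      ((1 + p ^ (2 * N + 1)) * A + p ^ N * B + p ^ (N + 1) * C)) UNIV"
    by (intro has_sum_add has_sum_cmult_right A B' C')
  thus ?thesis
    by (simp only: jacobi_coeff_Suc[OF p] distrib_right mult.assoc)
qed

lemma has_sum_jacobi_coeff:
  assumes p: "0 < p" "p < 1" and w: "w \<noteq> (0 :: real)"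
  shows "((\<lambda>k. jacobi_coeff p N k * w powi k) has_sum (\<Prod>n<N. (1 + w * p ^ n) * (1 + p ^ Suc n / w))) UNIV"
proof (induction N)
  case 0
  show ?case
    using p by (intro has_sum_finite_neutralI[of "{0}"]) (auto simp: jacobi_coeff_0)
next
  case (Suc N)
  define P where "P = (\<Prod>n<N. (1 + w * p ^ n) * (1 + p ^ Suc n / w))"
  have "((\<lambda>k. jacobi_coeff p (Suc N) k * w powi k) has_sum
      ((1 + p ^ (2 * N + 1)) * P + p ^ N * (w * P) + p ^ (N + 1) * (P / w))) UNIV"
  proof (rule has_sum_jacobi_coeff_Suc[OF p])
    show "((\<lambda>k. jacobi_coeff p N k * w powi k) has_sum P) UNIV"
      unfolding P_def by (rule Suc)
    from has_sum_cmult_right[OF this, of w]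
    show "((\<lambda>k. jacobi_coeff p N k * w powi (k + 1)) has_sum w * P) UNIV"
      using w by (simp add: power_int_add_1 mult_ac)
    from has_sum_cmult_left[OF \<open>((\<lambda>k. jacobi_coeff p N k * w powi k) has_sum P) UNIV\<close>, of "1 / w"]
    show "((\<lambda>k. jacobi_coeff p N k * w powi (k - 1)) has_sum P / w) UNIV"
      using w by (simp add: power_int_diff)
  qed
  also have "(1 + p ^ (2 * N + 1)) * P + p ^ N * (w * P) + p ^ (N + 1) * (P / w)
     = P * ((1 + w * p ^ N) * (1 + p ^ Suc N / w))"
    using w by (simp add: field_simps power_add mult_2_right)
  finally show ?case by (simp add: P_def)
qed

text \<open>This is w d/dw of the finite triple product at w = -1, obtained from the recurrence
  instead of by differentiation. The factor 1 + w vanishes there, so the product of the other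
  factors remains; the index \<open>Suc N\<close> ensures that this factor is present.\<close>

lemma has_sum_weighted_jacobi_coeff:
  assumes p: "0 < p" "p < 1"
  shows "((\<lambda>k. jacobi_coeff p (Suc N) k * (real_of_int k * (- 1) powi k)) has_sum
     - ((\<Prod>n<N. 1 - p ^ Suc n) * (\<Prod>n<Suc N. 1 - p ^ Suc n))) UNIV"
proof -
  define P where "P = (\<lambda>N. \<Prod>n<N. (1 + (- 1) * p ^ n) * (1 + p ^ Suc n / (- 1)))"
  have P: "((\<lambda>k. jacobi_coeff p N k * (- 1) powi k) has_sum P N) UNIV" for N
    unfolding P_def by (rule has_sum_jacobi_coeff) (use p in auto)
  \<comment> \<open>The term in \<open>P N\<close> comes from shifting the weight k by one. It
    contributes only at N = 0, since \<open>P\<close> vanishes from 1 on.\<close>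
  have step: "((\<lambda>k. jacobi_coeff p (Suc N) k * (real_of_int k * (- 1) powi k)) has_sum
     (1 - p ^ N) * (1 - p ^ Suc N) * D + (p ^ Suc N - p ^ N) * P N) UNIV"
    if D: "((\<lambda>k. jacobi_coeff p N k * (real_of_int k * (- 1) powi k)) has_sum D) UNIV" for D N
  proof -
    have "((\<lambda>k. jacobi_coeff p (Suc N) k * (real_of_int k * (- 1) powi k)) has_sum
      ((1 + p ^ (2 * N + 1)) * D + p ^ N * - (D + P N) + p ^ (N + 1) * - (D + - P N))) UNIV"
    proof (rule has_sum_jacobi_coeff_Suc[OF p D])
      show "((\<lambda>k. jacobi_coeff p N k * (real_of_int (k + 1) * (- 1) powi (k + 1))) has_sum - (D + P N)) UNIV"
        using has_sum_uminusI[OF has_sum_add[OF D P]] by (simp add: power_int_add_1 algebra_simps)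
      show "((\<lambda>k. jacobi_coeff p N k * (real_of_int (k - 1) * (- 1) powi (k - 1))) has_sum - (D + - P N)) UNIV"
        using has_sum_uminusI[OF has_sum_add[OF D has_sum_uminusI[OF P]]] by (simp add: power_int_diff algebra_simps)
    qed
    also have "(1 + p ^ (2 * N + 1)) * D + p ^ N * - (D + P N) + p ^ (N + 1) * - (D + - P N)
      = (1 - p ^ N) * (1 - p ^ Suc N) * D + (p ^ Suc N - p ^ N) * P N"
      by (simp add: algebra_simps power_add mult_2_right)
    finally show ?thesis .
  qed
  show ?thesis
  proof (induction N)
    case 0
    have "((\<lambda>k. jacobi_coeff p 0 k * (real_of_int k * (- 1) powi k)) has_sum 0) UNIV"
      by (rule has_sum_0) (auto simp: jacobi_coeff_0)
    from step[OF this] show ?case by (simp add: P_def)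
  next
    case (Suc N)
    have "P (Suc N) = 0" unfolding P_def by (rule prod_zero) (auto intro: bexI[of _ 0])
    thus ?case
      using step[OF Suc] by (simp add: algebra_simps)
  qed
qed

section \<open>Passage to the infinite triple product\<close>

lemma tannery_int:
  fixes f :: "nat \<Rightarrow> int \<Rightarrow> real"
  assumes lim: "\<And>k. (\<lambda>N. f N k) \<longlonglongrightarrow> b k" and bound: "\<And>N k. \<bar>f N k\<bar> \<le> M k"
    and M: "summable (\<lambda>n. M (int n))" "summable (\<lambda>n. M (- 1 - int n))"
    and S: "\<And>N. (f N has_sum S N) UNIV"
  shows "S \<longlonglongrightarrow> (\<Sum>\<^sub>\<infinity>k. b k)"
proof -
  have b: "\<bar>b k\<bar> \<le> M k" for k
    by (rule LIMSEQ_le_const2[OF tendsto_rabs[OF lim]]) (use bound in auto)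
  have split: "(h has_sum (\<Sum>n. h (int n) + h (- 1 - int n))) UNIV" if "\<And>k. \<bar>h k\<bar> \<le> M k" for h
    using that by (intro has_sum_int_split summable_comparison_test'[OF M(1), of 0]
      summable_comparison_test'[OF M(2), of 0]) auto
  have "S = (\<lambda>N. \<Sum>n. f N (int n) + f N (- 1 - int n))"
    by (rule ext) (rule has_sum_unique[OF S split[OF bound]])
  moreover have "(\<lambda>N. \<Sum>n. f N (int n) + f N (- 1 - int n)) \<longlonglongrightarrow> (\<Sum>n. b (int n) + b (- 1 - int n))"
  proof (rule tannerys_theorem[THEN conjunct2, THEN conjunct2])
    show "(\<lambda>N. f N (int n) + f N (- 1 - int n)) \<longlonglongrightarrow> b (int n) + b (- 1 - int n)" for n
      by (intro tendsto_add lim)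
    show "\<forall>\<^sub>F (n, N) in sequentially \<times>\<^sub>F sequentially.
        norm (f N (int n) + f N (- 1 - int n)) \<le> M (int n) + M (- 1 - int n)"
      by (intro always_eventually) (auto intro!: order_trans[OF abs_triangle_ineq] add_mono bound)
    show "summable (\<lambda>n. M (int n) + M (- 1 - int n))"
      by (intro summable_add M)
  qed auto
  moreover have "(\<Sum>n. b (int n) + b (- 1 - int n)) = (\<Sum>\<^sub>\<infinity>k. b k)"
    by (rule infsumI[OF split[OF b], symmetric])
  ultimately show "S \<longlonglongrightarrow> (\<Sum>\<^sub>\<infinity>k. b k)" by simp
qed

text \<open>With F the Euler product, the quotient of Pochhammer symbols in the k-th coefficient
  tends to F / F^2 and is at most 1 / F^2 for all N, so dominated convergence applies. The linear
  factor in the bound on \<open>u\<close> admits the weight k of the cube identity.\<close>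

lemma jacobi_limit:
  assumes p: "0 < p" "p < 1" and w: "w > (0 :: real)"
    and u: "\<And>k. \<bar>u k\<bar> \<le> (1 + \<bar>real_of_int k\<bar>) * w powr real_of_int k"
    and S: "\<And>N. ((\<lambda>k. jacobi_coeff p N k * u k) has_sum S N) UNIV"
  shows "S \<longlonglongrightarrow> (\<Sum>\<^sub>\<infinity>k. p powr (real_of_int k * (real_of_int k - 1) / 2) * u k) / ramanujan_f (- p)"
proof -
  define F where "F = ramanujan_f (- p)"
  have F: "F > 0" unfolding F_def by (rule ramanujan_f_pos[OF p])
  define e where "e = (\<lambda>k. p powr (real_of_int k * (real_of_int k - 1) / 2))"
  define M where "M = (\<lambda>k. (1 + \<bar>real_of_int k\<bar>) * w powr real_of_int k * e k * (1 / F\<^sup>2))"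
  have "S \<longlonglongrightarrow> (\<Sum>\<^sub>\<infinity>k. e k * u k / F)"
  proof (rule tannery_int[OF _ _ _ _ S])
    fix k
    have shift: "filterlim (\<lambda>N. nat (int N + j)) at_top sequentially" for j
      unfolding filterlim_at_top
    proof
      fix Z
      show "\<forall>\<^sub>F N in sequentially. Z \<le> nat (int N + j)"
        using eventually_ge_at_top[of "Z + nat (- j)"] by eventually_elim linarith
    qed
    have "(\<lambda>N. \<Prod>i<2 * N. 1 - p ^ Suc i) \<longlonglongrightarrow> F"
      unfolding F_def
      by (rule filterlim_compose[OF euler_product_LIMSEQ[OF p]]) (simp add: mult_nat_left_at_top)
    moreover have "(\<lambda>N. qfact_inv p (int N - k)) \<longlonglongrightarrow> 1 / F" "(\<lambda>N. qfact_inv p (int N + k)) \<longlonglongrightarrow> 1 / F"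
      unfolding F_def using shift[of "- k"] by (intro qfact_inv_LIMSEQ p shift; simp)+
    ultimately have "(\<lambda>N. (\<Prod>i<2 * N. 1 - p ^ Suc i) * qfact_inv p (int N - k) * qfact_inv p (int N + k) * e k * u k)
        \<longlonglongrightarrow> F * (1 / F) * (1 / F) * e k * u k"
      by (intro tendsto_mult tendsto_const)
    thus "(\<lambda>N. jacobi_coeff p N k * u k) \<longlonglongrightarrow> e k * u k / F"
      using F by (simp add: jacobi_coeff_def e_def)
    fix N
    have p1: "0 \<le> p ^ Suc i" "p ^ Suc i \<le> 1" for i
      using p power_le_one[of p "Suc i"] by auto
    have "0 \<le> (\<Prod>i<2 * N. 1 - p ^ Suc i)" "(\<Prod>i<2 * N. 1 - p ^ Suc i) \<le> 1"
      by (intro prod_nonneg prod_le_1; use p1 in simp)+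
    hence "\<bar>jacobi_coeff p N k\<bar> = (\<Prod>i<2 * N. 1 - p ^ Suc i) * qfact_inv p (int N - k) * qfact_inv p (int N + k) * e k"
      unfolding jacobi_coeff_def abs_mult e_def using qfact_inv_bound(1)[OF p] by simp
    also have "\<dots> \<le> 1 * (1 / F) * (1 / F) * e k"
      using \<open>0 \<le> (\<Prod>i<2 * N. 1 - p ^ Suc i)\<close> \<open>(\<Prod>i<2 * N. 1 - p ^ Suc i) \<le> 1\<close> F qfact_inv_bound[OF p]
      unfolding F_def [symmetric] by (intro mult_mono mult_nonneg_nonneg; simp add: e_def)
    finally have "\<bar>jacobi_coeff p N k\<bar> \<le> 1 * (1 / F) * (1 / F) * e k" .
    hence "\<bar>jacobi_coeff p N k * u k\<bar> \<le> 1 * (1 / F) * (1 / F) * e k * ((1 + \<bar>real_of_int k\<bar>) * w powr real_of_int k)"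
      unfolding abs_mult using F by (intro mult_mono u) (auto simp: e_def)
    thus "\<bar>jacobi_coeff p N k * u k\<bar> \<le> M k"
      by (simp add: M_def power2_eq_square mult_ac)
  next
    show "summable (\<lambda>n. M (int n))"
      using summable_jacobi_nat[OF p w] unfolding M_def e_def
      by (intro summable_mult2) simp
    \<comment> \<open>For k = -m the exponent is m(m+1)/2 = m + m(m-1)/2, so the negative half is a
      series of the same shape with \<open>p / w\<close> in place of \<open>w\<close>.\<close>
    have "summable (\<lambda>n. (1 + real n) * (p / w) powr real n * p powr (real n * (real n - 1) / 2))"
      using p w by (intro summable_jacobi_nat) auto
    hence "summable (\<lambda>n. (1 + real (Suc n)) * (p / w) powr real (Suc n) * p powr (real (Suc n) * (real (Suc n) - 1) / 2))"
      by (subst summable_Suc_iff)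
    also have "(\<lambda>n. (1 + real (Suc n)) * (p / w) powr real (Suc n) * p powr (real (Suc n) * (real (Suc n) - 1) / 2))
       = (\<lambda>n. (1 + \<bar>real_of_int (- 1 - int n)\<bar>) * w powr real_of_int (- 1 - int n) * e (- 1 - int n))"
    proof
      fix n
      define m where "m = real (Suc n)"
      have m: "real_of_int (- 1 - int n) = - m" "m > 0" by (auto simp: m_def)
      have "(p / w) powr m * p powr (m * (m - 1) / 2) = w powr (- m) * (p powr m * p powr (m * (m - 1) / 2))"
        using p w by (simp add: powr_divide powr_minus_divide)
      also have "p powr m * p powr (m * (m - 1) / 2) = p powr (- m * (- m - 1) / 2)"
        unfolding powr_add [symmetric] by (intro arg_cong[of _ _ "\<lambda>t. p powr t"]) (simp add: field_simps)
      finally have eq: "(p / w) powr m * p powr (m * (m - 1) / 2) = w powr (- m) * p powr (- m * (- m - 1) / 2)" .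
      show "(1 + real (Suc n)) * (p / w) powr real (Suc n) * p powr (real (Suc n) * (real (Suc n) - 1) / 2)
         = (1 + \<bar>real_of_int (- 1 - int n)\<bar>) * w powr real_of_int (- 1 - int n) * e (- 1 - int n)"
        unfolding e_def m(1) m_def [symmetric] mult.assoc eq using m(2) by simp
    qed
    finally show "summable (\<lambda>n. M (- 1 - int n))"
      unfolding M_def by (rule summable_mult2)
  qed
  thus ?thesis
    unfolding e_def F_def by (simp only: divide_inverse infsum_cmult_left')
qed

text \<open>Stated as a limit of partial products, so that several triple products can be multiplied
  and regrouped at a finite stage.\<close>

theorem jacobi_triple_product:
  fixes p w :: real
  assumes p: "0 < p" "p < 1" and w: "w \<noteq> 0"
  shows "(\<lambda>N. \<Prod>n<N. (1 + w * p ^ n) * (1 + p ^ Suc n / w)) \<longlonglongrightarrow>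
    (\<Sum>\<^sub>\<infinity>k. p powr (real_of_int k * (real_of_int k - 1) / 2) * w powi k) / ramanujan_f (- p)"
proof (rule jacobi_limit[OF p, of "\<bar>w\<bar>"])
  show "\<bar>w powi k\<bar> \<le> (1 + \<bar>real_of_int k\<bar>) * \<bar>w\<bar> powr real_of_int k" for k
  proof -
    have "\<bar>w powi k\<bar> = \<bar>w\<bar> powr real_of_int k"
      using w by (simp add: powr_real_of_int' power_int_abs)
    thus ?thesis
      using mult_right_mono[of 1 "1 + \<bar>real_of_int k\<bar>" "\<bar>w\<bar> powr real_of_int k"] by simp
  qed
qed (use w has_sum_jacobi_coeff[OF p w] in auto)

theorem jacobi_cube:
  fixes p :: real
  assumes p: "0 < p" "p < 1"
  shows "(\<Sum>\<^sub>\<infinity>k. p powr (real_of_int k * (real_of_int k - 1) / 2) * (real_of_int k * (- 1) powi k))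
    = - (ramanujan_f (- p) ^ 3)"
proof -
  \<comment> \<open>The closed form starts at index 1; at index 0 the only nonzero coefficient is
    the one with weight k = 0.\<close>
  define S where "S = (\<lambda>N. if N = 0 then 0 else - ((\<Prod>n<N - 1. 1 - p ^ Suc n) * (\<Prod>n<N. 1 - p ^ Suc n)))"
  have "((\<lambda>k. jacobi_coeff p N k * (real_of_int k * (- 1) powi k)) has_sum S N) UNIV" for N
  proof (cases N)
    case 0
    thus ?thesis by (auto simp: S_def jacobi_coeff_0 intro!: has_sum_0)
  next
    case (Suc n)
    thus ?thesis using has_sum_weighted_jacobi_coeff[OF p, of n] by (simp add: S_def)
  qed
  hence "S \<longlonglongrightarrow> (\<Sum>\<^sub>\<infinity>k. p powr (real_of_int k * (real_of_int k - 1) / 2) * (real_of_int k * (- 1) powi k)) / ramanujan_f (- p)"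
    by (intro jacobi_limit[OF p, of 1]) (auto simp: abs_mult power_int_minus_one_minus)
  hence "(\<lambda>N. S (Suc N)) \<longlonglongrightarrow> (\<Sum>\<^sub>\<infinity>k. p powr (real_of_int k * (real_of_int k - 1) / 2) * (real_of_int k * (- 1) powi k)) / ramanujan_f (- p)"
    by (rule LIMSEQ_Suc)
  moreover have "(\<lambda>N. S (Suc N)) \<longlonglongrightarrow> - (ramanujan_f (- p) * ramanujan_f (- p))"
    unfolding S_def using euler_product_LIMSEQ[OF p] LIMSEQ_Suc[OF euler_product_LIMSEQ[OF p]]
    by (simp del: prod.lessThan_Suc) (intro tendsto_intros; assumption)
  ultimately have "(\<Sum>\<^sub>\<infinity>k. p powr (real_of_int k * (real_of_int k - 1) / 2) * (real_of_int k * (- 1) powi k)) / ramanujan_f (- p)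
     = - (ramanujan_f (- p) * ramanujan_f (- p))"
    by (rule LIMSEQ_unique)
  thus ?thesis
    using ramanujan_f_pos[OF p] by (simp add: field_simps power3_eq_cube)
qed

section \<open>The Rogers--Ramanujan continued fraction\<close>

text \<open>The division is exact, as r and 5r + 1 have opposite parity.\<close>

definition hw_exponent :: "nat \<Rightarrow> nat" where
  "hw_exponent r = r * (5 * r + 1) div 2"

lemma hw_exponent_Suc: "hw_exponent (Suc r) = hw_exponent r + 5 * r + 3"
proof -
  have "Suc r * (5 * Suc r + 1) = r * (5 * r + 1) + 2 * (5 * r + 3)" by (simp add: algebra_simps)
  thus ?thesis by (simp add: hw_exponent_def)
qed

lemma real_hw_exponent: "real (hw_exponent r) = real r * (5 * real r + 1) / 2"
  by (induction r) (simp_all add: hw_exponent_Suc, simp_all add: hw_exponent_def field_simps)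

lemma hw_exponent_ge: "r \<le> hw_exponent r"
  by (induction r) (simp_all add: hw_exponent_Suc)

text \<open>The quotient (q; q)_(n+r) / (q; q)_r.\<close>

definition qprod :: "real \<Rightarrow> nat \<Rightarrow> nat \<Rightarrow> real" where
  "qprod q n r = (\<Prod>s<n. 1 - q ^ (r + s + 1))"

lemma qprod_Suc: "qprod q (Suc n) r = qprod q n r * (1 - q ^ (n + r + 1))"
  by (simp add: qprod_def add_ac)

lemma qprod_shift: "(1 - q ^ Suc r) * qprod q n (Suc r) = qprod q (Suc n) r"
  unfolding qprod_def by (subst prod.lessThan_Suc_shift) (simp add: add_ac)

lemma power_unit_interval:
  fixes q :: real
  assumes "0 < q" "q < 1"
  shows "0 \<le> 1 - q ^ n" "1 - q ^ n \<le> 1"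
  using assms power_le_one[of q n] by auto

lemma qprod_bounds:
  assumes "0 < q" "q < 1"
  shows "0 \<le> qprod q n r" "qprod q n r \<le> 1"
  unfolding qprod_def by (intro prod_nonneg prod_le_1 conjI ballI power_unit_interval assms)+

text \<open>The terms of \<open>H\<^sub>1(a)\<close> and \<open>H\<^sub>2(a)\<close> of Hardy and Wright at \<open>a = q ^ (n + 1)\<close>, multiplied by the Euler
  product so that the infinite products become the finite \<open>qprod\<close>.\<close>
definition hw1 :: "real \<Rightarrow> nat \<Rightarrow> nat \<Rightarrow> real" where
  "hw1 q n r = (- 1) ^ r * q ^ (2 * n * r + r + hw_exponent r) * ((1 - q ^ (n + 1 + 2 * r)) * qprod q n r)"

definition hw2 :: "real \<Rightarrow> nat \<Rightarrow> nat \<Rightarrow> real" where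
  "hw2 q n r = (- 1) ^ r * q ^ (2 * n * r + hw_exponent r) * ((1 - q ^ (2 * n + 2 + 4 * r)) * qprod q n r)"

lemma hw_term_bound:
  fixes q :: real
  assumes q: "0 < q" "q < 1" and "k \<le> j"
  shows "\<bar>(- 1) ^ r * q ^ j * ((1 - q ^ i) * qprod q n s)\<bar> \<le> q ^ k"
proof -
  have "0 \<le> (1 - q ^ i) * qprod q n s" "(1 - q ^ i) * qprod q n s \<le> 1"
    by (intro mult_nonneg_nonneg mult_le_one power_unit_interval qprod_bounds q)+
  hence "\<bar>(1 - q ^ i) * qprod q n s\<bar> \<le> 1" by simp
  moreover have "q ^ j \<le> q ^ k" using assms by (intro power_decreasing) auto
  ultimately have "q ^ j * \<bar>(1 - q ^ i) * qprod q n s\<bar> \<le> q ^ k * 1"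
    using q by (intro mult_mono) auto
  thus ?thesis using q by (simp add: abs_mult power_abs)
qed

lemma summable_hw:
  assumes q: "0 < q" "q < 1"
  shows "summable (hw1 q n)" "summable (hw2 q n)"
proof -
  have geo: "summable (\<lambda>r. q ^ r)" using q by (intro summable_geometric) auto
  have "norm (hw1 q n r) \<le> q ^ r" "norm (hw2 q n r) \<le> q ^ r" for r
    using hw_exponent_ge[of r] unfolding hw1_def hw2_def real_norm_def
    by (intro hw_term_bound q; simp)+
  thus "summable (hw1 q n)" "summable (hw2 q n)"
    by (blast intro: summable_comparison_test'[OF geo])+
qed

section \<open>The functional equations, by telescoping\<close>

lemma suminf_eq_telescoping:
  fixes f g T :: "nat \<Rightarrow> real"
  assumes "summable f" "summable g" "\<And>r. f r = g r + (T (Suc r) - T r)" "T 0 = 0" "T \<longlonglongrightarrow> 0"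
  shows "suminf f = suminf g"
proof -
  have "(\<lambda>r. g r + (T (Suc r) - T r)) sums (suminf g + (0 - T 0))"
    by (intro sums_add telescope_sums summable_sums assms)
  hence "f sums suminf g" unfolding assms(3) [symmetric] assms(4) by simp
  thus ?thesis by (rule sums_unique [symmetric])
qed

lemma hw_telescoper_tendsto_0:
  assumes q: "0 < q" "q < 1" and "\<And>r. r \<le> j r"
  shows "(\<lambda>r. (- 1) ^ r * q ^ j r * ((1 - q ^ r) * qprod q n r)) \<longlonglongrightarrow> 0"
proof (rule Lim_null_comparison)
  show "(\<lambda>r. q ^ r) \<longlonglongrightarrow> 0" using q by (intro LIMSEQ_power_zero) auto
  show "\<forall>\<^sub>F r in sequentially. norm ((- 1) ^ r * q ^ j r * ((1 - q ^ r) * qprod q n r)) \<le> q ^ r"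
    unfolding real_norm_def by (intro always_eventually allI hw_term_bound q assms)
qed

lemma suminf_hw1:
  assumes q: "0 < q" "q < 1"
  shows "(\<Sum>r. hw1 q n r) = (\<Sum>r. hw2 q (Suc n) r)"
proof (rule suminf_eq_telescoping [symmetric])
  \<comment> \<open>Since 1 - q^(n+1+2r) = (1 - q^r) + q^r (1 - q^(n+1+r)), removing
    \<open>T r\<close> from \<open>hw1 q n r\<close> leaves a multiple of
    \<open>qprod q (Suc n) r\<close>; adding \<open>T (Suc r)\<close> completes it to
    \<open>hw2 q (Suc n) r\<close>.\<close>
  define T where "T = (\<lambda>r. (- 1) ^ r * q ^ (2 * n * r + r + hw_exponent r) * ((1 - q ^ r) * qprod q n r))"
  show "T 0 = 0" by (simp add: T_def)
  show "T \<longlonglongrightarrow> 0"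
    unfolding T_def using hw_exponent_ge by (intro hw_telescoper_tendsto_0 q) (simp add: trans_le_add2)
  fix r
  define E W where "E = (- 1) ^ r * q ^ (2 * n * r + r + hw_exponent r)" and "W = qprod q n r"
  define a b where "a = q ^ n" and "b = q ^ r"
  have pw: "q ^ (2 * n + 5 * r + 4) = a\<^sup>2 * b ^ 5 * q ^ 4" "q ^ (n + r + 1) = a * b * q"
    "q ^ (n + 1 + 2 * r) = a * q * b\<^sup>2" "q ^ (2 * n + 4 + 4 * r) = a\<^sup>2 * q ^ 4 * b ^ 4"
    by (simp_all add: a_def b_def power_add power_mult [symmetric] mult.commute)
  have "T (Suc r) = - (E * q ^ (2 * n + 5 * r + 4) * ((1 - q ^ Suc r) * qprod q n (Suc r)))"
    by (simp add: T_def E_def hw_exponent_Suc power_add mult_ac power_eq_if[of q 4] numeral_3_eq_3)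
  hence "T (Suc r) = - (E * q ^ (2 * n + 5 * r + 4) * (W * (1 - q ^ (n + r + 1))))"
    unfolding qprod_shift qprod_Suc W_def .
  moreover have "T r = E * ((1 - q ^ r) * W)"
    by (simp add: T_def E_def W_def)
  moreover have "hw1 q n r = E * ((1 - q ^ (n + 1 + 2 * r)) * W)"
    by (simp add: hw1_def E_def W_def)
  moreover have "hw2 q (Suc n) r = E * q ^ r * ((1 - q ^ (2 * n + 4 + 4 * r)) * (W * (1 - q ^ (n + r + 1))))"
  proof -
    have "2 * Suc n * r + hw_exponent r = (2 * n * r + r + hw_exponent r) + r" "2 * Suc n + 2 + 4 * r = 2 * n + 4 + 4 * r"
      by simp_all
    thus ?thesis unfolding hw2_def E_def W_def qprod_Suc by (simp only: power_add mult.assoc)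
  qed
  moreover have "E * b * ((1 - a\<^sup>2 * q ^ 4 * b ^ 4) * (W * (1 - a * b * q))) = E * ((1 - a * q * b\<^sup>2) * W) +
        (- (E * (a\<^sup>2 * b ^ 5 * q ^ 4) * (W * (1 - a * b * q))) - E * ((1 - b) * W))"
    by (simp add: algebra_simps eval_nat_numeral)
  ultimately show "hw2 q (Suc n) r = hw1 q n r + (T (Suc r) - T r)"
    unfolding pw b_def [symmetric] by (simp only:)
qed (use summable_hw[OF q] in auto)

text \<open>The equation H_2(a) - H_1(a) = a H_1(aq), combined with H_1(a) = H_2(aq), gives the
  three-term recurrence that generates the continued fraction.\<close>

lemma suminf_hw2:
  assumes q: "0 < q" "q < 1"
  shows "(\<Sum>r. hw2 q n r) = (\<Sum>r. hw2 q (Suc n) r) + q ^ Suc n * (\<Sum>r. hw2 q (Suc (Suc n)) r)"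
proof -
  \<comment> \<open>Removing \<open>U r\<close> from \<open>hw2 q n r - hw1 q n r\<close> leaves a
    multiple of 1 - q^(n+1+r), which turns \<open>qprod q n r\<close> into
    \<open>qprod q (Suc n) r\<close>; \<open>U (Suc r)\<close> supplies the second half of the
    target term.\<close>
  define U where "U = (\<lambda>r. (- 1) ^ r * q ^ (2 * n * r + hw_exponent r) * ((1 - q ^ r) * qprod q n r))"
  have "(\<Sum>r. q ^ Suc n * hw1 q (Suc n) r) = (\<Sum>r. hw2 q n r - hw1 q n r)"
  proof (rule suminf_eq_telescoping)
    show "U 0 = 0" by (simp add: U_def)
    show "U \<longlonglongrightarrow> 0"
      unfolding U_def using hw_exponent_ge by (intro hw_telescoper_tendsto_0 q) (simp add: trans_le_add2)
    fix r
    define E W where "E = (- 1) ^ r * q ^ (2 * n * r + hw_exponent r)" and "W = qprod q n r"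
    define a b where "a = q ^ n" and "b = q ^ r"
    have pw: "q ^ (2 * n + 5 * r + 3) = a\<^sup>2 * b ^ 5 * q ^ 3" "q ^ (n + r + 1) = a * b * q"
      "q ^ (2 * n + 2 + 4 * r) = a\<^sup>2 * q\<^sup>2 * b ^ 4" "q ^ (n + 1 + 2 * r) = a * q * b\<^sup>2"
      "q ^ (n + 1 + 3 * r) = a * q * b ^ 3" "q ^ (n + 2 + 2 * r) = a * q\<^sup>2 * b\<^sup>2"
      by (simp_all add: a_def b_def power_add power_mult [symmetric] mult.commute) (simp_all add: power2_eq_square)
    have "U (Suc r) = - (E * q ^ (2 * n + 5 * r + 3) * ((1 - q ^ Suc r) * qprod q n (Suc r)))"
      by (simp add: U_def E_def hw_exponent_Suc power_add mult_ac)
    hence "U (Suc r) = - (E * q ^ (2 * n + 5 * r + 3) * (W * (1 - q ^ (n + r + 1))))"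
      unfolding qprod_shift qprod_Suc W_def .
    moreover have "U r = E * ((1 - q ^ r) * W)"
      by (simp add: U_def E_def W_def)
    moreover have "hw2 q n r = E * ((1 - q ^ (2 * n + 2 + 4 * r)) * W)"
      by (simp add: hw2_def E_def W_def)
    moreover have "hw1 q n r = E * q ^ r * ((1 - q ^ (n + 1 + 2 * r)) * W)"
      by (simp add: hw1_def E_def W_def power_add mult_ac)
    moreover have "q ^ Suc n * hw1 q (Suc n) r = E * q ^ (n + 1 + 3 * r) * ((1 - q ^ (n + 2 + 2 * r)) * (W * (1 - q ^ (n + r + 1))))"
      by (simp add: hw1_def E_def W_def qprod_Suc power_add mult_ac) 
    moreover have "E * (a * q * b ^ 3) * ((1 - a * q\<^sup>2 * b\<^sup>2) * (W * (1 - a * b * q))) =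
        E * ((1 - a\<^sup>2 * q\<^sup>2 * b ^ 4) * W) - E * b * ((1 - a * q * b\<^sup>2) * W) +
        (- (E * (a\<^sup>2 * b ^ 5 * q ^ 3) * (W * (1 - a * b * q))) - E * ((1 - b) * W))"
      by (simp add: algebra_simps eval_nat_numeral)
    ultimately show "q ^ Suc n * hw1 q (Suc n) r = hw2 q n r - hw1 q n r + (U (Suc r) - U r)"
      unfolding pw b_def [symmetric] by (simp only:)
  qed (use summable_hw[OF q] in \<open>auto intro!: summable_mult summable_diff\<close>)
  thus ?thesis
    using summable_hw[OF q] by (simp add: suminf_mult suminf_diff [symmetric] suminf_hw1[OF q])
qed

text \<open>For large n the term r = 0 dominates, because the others are O(q^(2n)). The recurrence
  has positive coefficients and carries positivity down to every n.\<close>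

lemma suminf_hw2_pos:
  assumes q: "0 < q" "q < 1"
  shows "(\<Sum>r. hw2 q n r) > 0"
proof -
  define h where "h = (\<lambda>n. \<Sum>r. hw2 q n r)"
  define F where "F = ramanujan_f (- q)"
  have F: "F > 0" unfolding F_def by (rule ramanujan_f_pos[OF q])
  have rec: "h n = h (Suc n) + q ^ Suc n * h (Suc (Suc n))" for n
    unfolding h_def by (rule suminf_hw2[OF q])
  have ge: "h n \<ge> (1 - q ^ 2) * F - q ^ (2 * n) * (1 / (1 - q))" for n
  proof -
    have "norm (hw2 q n (Suc r)) \<le> q ^ (2 * n) * q ^ r" for r
      using hw_exponent_ge[of "Suc r"] unfolding hw2_def real_norm_def power_add [symmetric]
      by (intro hw_term_bound q) (simp add: add_mono)
    moreover have "(\<lambda>r. q ^ (2 * n) * q ^ r) sums (q ^ (2 * n) * (1 / (1 - q)))"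
      using q by (intro sums_mult geometric_sums) auto
    ultimately have "norm (\<Sum>r. hw2 q n (Suc r)) \<le> q ^ (2 * n) * (1 / (1 - q))"
      by (metis norm_suminf_le sums_summable sums_unique)
    moreover have "h n = hw2 q n 0 + (\<Sum>r. hw2 q n (Suc r))"
      unfolding h_def using suminf_split_head[OF summable_hw(2)[OF q]] by simp
    moreover have "hw2 q n 0 \<ge> (1 - q ^ 2) * F"
    proof -
      have "hw2 q n 0 = (1 - q ^ (2 * n + 2)) * (\<Prod>i<n. 1 - q ^ Suc i)"
        by (simp add: hw2_def hw_exponent_def qprod_def)
      moreover have "q ^ (2 * n + 2) \<le> q ^ 2" using q by (intro power_decreasing) auto
      ultimately show ?thesis
        unfolding F_def using ramanujan_f_le[OF q, of n] ramanujan_f_pos[OF q] power_unit_interval(1)[OF q, of "2 * n + 2"]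
        by (simp only:) (intro mult_mono; simp)
    qed
    ultimately show ?thesis by simp
  qed
  have "(\<lambda>n. (1 - q ^ 2) * F - q ^ (2 * n) * (1 / (1 - q))) \<longlonglongrightarrow> (1 - q ^ 2) * F - 0 * (1 / (1 - q))"
  proof (intro tendsto_intros)
    have "(\<lambda>n. (q ^ 2) ^ n) \<longlonglongrightarrow> 0"
      using q by (intro LIMSEQ_power_zero) (simp add: power_less_one_iff)
    thus "(\<lambda>n. q ^ (2 * n)) \<longlonglongrightarrow> 0" by (simp add: power_mult)
  qed
  moreover have "(1 - q ^ 2) * F - 0 * (1 / (1 - q)) > 0"
    using q F by (simp add: power_less_one_iff)
  ultimately have "\<forall>\<^sub>F n in sequentially. (1 - q ^ 2) * F - q ^ (2 * n) * (1 / (1 - q)) > 0"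
    by (rule order_tendstoD)
  hence "\<forall>\<^sub>F n in sequentially. h n > 0"
    by eventually_elim (rule less_le_trans[OF _ ge])
  then obtain N where N: "\<And>n. n \<ge> N \<Longrightarrow> h n > 0" by (auto simp: eventually_sequentially)
  \<comment> \<open>Downward induction needs two consecutive values; once k reaches N, truncated
    subtraction keeps the index at 0.\<close>
  have "h (N - k) > 0 \<and> h (Suc (N - k)) > 0" for k
  proof (induction k)
    case 0
    show ?case using N[of N] N[of "Suc N"] by simp
  next
    case (Suc k)
    show ?case
    proof (cases "k < N")
      case True
      hence "Suc (N - Suc k) = N - k" by simp
      thus ?thesis
        using Suc rec[of "N - Suc k"] q by (simp add: add_pos_pos)
    qed (use Suc in simp)
  qed
  from this[of "N - n"] N[of n] have "h n > 0"
    by (cases "n \<le> N") auto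
  thus ?thesis by (simp add: h_def)
qed

text \<open>The quotients \<open>L n\<close> satisfy the recursion of the infinite tails exactly.
  All denominators are at least 1, so each further level multiplies the truncation error by at most
  \<open>q ^ n\<close>.\<close>

lemma rr_convergent_LIMSEQ:
  fixes h :: "nat \<Rightarrow> real"
  assumes q: "0 < q" "q < 1" and pos: "\<And>n. h n > 0"
    and rec: "\<And>n. h n = h (Suc n) + q ^ Suc n * h (Suc (Suc n))"
  shows "(\<lambda>m. rr_convergent q m 0) \<longlonglongrightarrow> h 1 / h 0"
proof -
  define L where "L = (\<lambda>n. q ^ n * h (Suc n) / h n)"
  have L0: "L n \<ge> 0" for n using pos[of n] pos[of "Suc n"] q by (simp add: L_def)
  have L: "L n = q ^ n / (1 + L (Suc n))" for n
  proof -
    have "1 + L (Suc n) = h n / h (Suc n)"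
      using pos[of "Suc n"] rec[of n] by (simp add: L_def field_simps)
    thus ?thesis by (simp add: L_def)
  qed
  have c0: "rr_convergent q m n \<ge> 0" for m n
    by (induction m arbitrary: n) (use q in auto)
  \<comment> \<open>Generalised over the starting level n, since one step of the fraction passes to
    the tail at \<open>Suc n\<close>.\<close>
  have "\<bar>rr_convergent q m n - L n\<bar> \<le> q ^ (n + m)" for m n
  proof (induction m arbitrary: n)
    case 0
    have "L n \<le> q ^ n / 1"
      unfolding L[of n] using L0[of "Suc n"] q by (intro divide_left_mono) auto
    thus ?case using L0[of n] by simp
  next
    case (Suc m)
    define c l where "c = rr_convergent q m (Suc n)" and "l = L (Suc n)"
    have cl: "c \<ge> 0" "l \<ge> 0" unfolding c_def l_def by (rule c0 L0)+
    have "rr_convergent q (Suc m) n - L n = q ^ n / (1 + c) - q ^ n / (1 + l)"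
      by (simp add: c_def l_def L[of n])
    also have "\<dots> = q ^ n * (l - c) / ((1 + c) * (1 + l))"
      using cl by (simp add: divide_simps) (simp add: algebra_simps)
    finally have "\<bar>rr_convergent q (Suc m) n - L n\<bar> = q ^ n * \<bar>c - l\<bar> / ((1 + c) * (1 + l))"
      using cl q by (simp add: abs_mult abs_minus_commute)
    also have "\<dots> \<le> q ^ n * \<bar>c - l\<bar> / 1"
      using cl q mult_mono[of 1 "1 + c" 1 "1 + l"] by (intro divide_left_mono) auto
    also have "\<dots> \<le> 1 * q ^ (Suc n + m)"
      unfolding div_by_1 c_def l_def using q by (intro mult_mono Suc) (auto simp: power_le_one)
    finally show ?case by simp
  qed
  hence "\<forall>\<^sub>F m in sequentially. norm (rr_convergent q m 0 - L 0) \<le> q ^ m"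
    by (intro always_eventually allI) (metis add_0 real_norm_def)
  moreover have "(\<lambda>m. q ^ m) \<longlonglongrightarrow> 0" using q by (intro LIMSEQ_power_zero) auto
  ultimately have "(\<lambda>m. rr_convergent q m 0 - L 0) \<longlonglongrightarrow> 0"
    by (rule Lim_null_comparison)
  hence "(\<lambda>m. rr_convergent q m 0) \<longlonglongrightarrow> L 0"
    by (simp add: LIM_zero_iff)
  thus ?thesis by (simp add: L_def)
qed

lemma rogers_ramanujan_eq_quotient:
  assumes q: "0 < q" "q < 1"
  shows "rogers_ramanujan q = q powr (1/5) * ((\<Sum>r. hw1 q 0 r) / (\<Sum>r. hw2 q 0 r))"
proof -
  have "(\<lambda>m. rr_convergent q m 0) \<longlonglongrightarrow> (\<Sum>r. hw2 q 1 r) / (\<Sum>r. hw2 q 0 r)"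
    by (rule rr_convergent_LIMSEQ[OF q, of "\<lambda>n. \<Sum>r. hw2 q n r"]) (rule suminf_hw2_pos[OF q], rule suminf_hw2[OF q])
  thus ?thesis
    unfolding rogers_ramanujan_def using suminf_hw1[OF q, of 0] by (simp add: limI)
qed

section \<open>Theta series as eta products\<close>

text \<open>The converse direction: both halves inherit absolute convergence from the unordered
  sum.\<close>

lemma has_sum_int_split':
  fixes f :: "int \<Rightarrow> real"
  assumes "(f has_sum S) UNIV"
  shows "(\<lambda>n. f (int n) + f (- 1 - int n)) sums S"
proof -
  have abs: "(\<lambda>k. \<bar>f k\<bar>) summable_on UNIV"
    using assms summable_on_iff_abs_summable_on_real[of f UNIV] by (auto simp: has_sum_iff)
  have "summable (\<lambda>n. \<bar>f (j n)\<bar>)" if "inj j" for j :: "nat \<Rightarrow> int"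
  proof -
    have "(\<lambda>k. \<bar>f k\<bar>) summable_on range j"
      by (rule summable_on_subset_banach[OF abs]) simp
    hence "(\<lambda>n. \<bar>f (j n)\<bar>) summable_on UNIV"
      using that by (simp add: summable_on_reindex o_def)
    thus ?thesis by (rule summable_on_imp_summable)
  qed
  hence s: "summable (\<lambda>n. \<bar>f (int n)\<bar>)" "summable (\<lambda>n. \<bar>f (- 1 - int n)\<bar>)"
    by (auto simp: inj_def)
  have "summable (\<lambda>n. f (int n) + f (- 1 - int n))"
    by (intro summable_add s[THEN summable_rabs_cancel])
  thus ?thesis
    using has_sum_unique[OF assms has_sum_int_split[OF s]] by (simp add: sums_iff)
qed

text \<open>The coefficients are supported on a single residue class, so the series can be reindexed
  along it.\<close>

lemma has_sum_theta_progression: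
  fixes x :: real
  assumes x: "0 < x" "x < 1" and c: "\<And>a. \<bar>c a\<bar> \<le> (1 + (real_of_int a)\<^sup>2)\<^sup>2"
    and m: "m \<noteq> 0" and s: "\<And>a. c a \<noteq> 0 \<Longrightarrow> m dvd a - s"
  shows "((\<lambda>k. c (m * k + s) * x powr (real_of_int (m * k + s))\<^sup>2) has_sum theta c x) UNIV"
proof -
  have "((\<lambda>a. c a * x powr (real_of_int a)\<^sup>2) has_sum theta c x) UNIV"
    by (rule has_sum_theta[OF x c])
  also have "?this \<longleftrightarrow> ((\<lambda>a. c a * x powr (real_of_int a)\<^sup>2) has_sum theta c x) (range (\<lambda>k. m * k + s))"
  proof (rule has_sum_cong_neutral)
    fix a assume "a \<in> UNIV - range (\<lambda>k. m * k + s)"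
    hence "a \<noteq> m * k + s" for k by blast
    hence "\<not> m dvd a - s" by (metis diff_add_cancel dvdE)
    hence "c a = 0" using s by blast
    thus "c a * x powr (real_of_int a)\<^sup>2 = 0" by simp
  qed auto
  also have "\<dots> \<longleftrightarrow> ?thesis"
    using m by (subst has_sum_reindex) (simp_all add: inj_def o_def)
  finally show ?thesis .
qed

lemma chi4_odd: "chi4 (2 * k + 1) = (if even k then 1 else - 1)"
proof (cases "even k")
  case True
  then obtain j where "k = 2 * j" by (elim evenE)
  hence "2 * k + 1 = 1 + 4 * j" by simp
  hence "(2 * k + 1) mod 4 = 1" by (simp only: mod_mult_self2) simp
  thus ?thesis using True by (simp add: chi4_def)
next
  case False
  then obtain j where "k = 2 * j + 1" by (elim oddE)
  hence "2 * k + 1 = 3 + 4 * j" by simp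
  hence "(2 * k + 1) mod 4 = 3" by (simp only: mod_mult_self2) simp
  thus ?thesis using False by (simp add: chi4_def)
qed

lemma chi4_even: "even a \<Longrightarrow> chi4 a = 0"
  unfolding chi4_def by (auto, presburger+)

text \<open>Odd numbers in a class modulo 5 form one class modulo 10. Class 2 is parametrised twice:
  the offset 7 suits the pairing k, -1 - k, and the offset -3 suits the triple product.\<close>

lemma chi4_class_progression:
  "chi4_class 1 (10 * k + 1) = (if even k then 1 else - 1)"
  "chi4_class 2 (10 * k + 7) = (if even k then - 1 else 1)"
  "chi4_class 2 (10 * k + - 3) = (if even k then 1 else - 1)"
proof -
  have "(10 * k + 1) mod 5 = 1" "(10 * k + 7) mod 5 = 2" "(10 * k + - 3) mod 5 = 2"
    by presburger+
  thus "chi4_class 1 (10 * k + 1) = (if even k then 1 else - 1)"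
    "chi4_class 2 (10 * k + 7) = (if even k then - 1 else 1)"
    "chi4_class 2 (10 * k + - 3) = (if even k then 1 else - 1)"
    using chi4_odd[of "5 * k"] chi4_odd[of "5 * k + 3"] chi4_odd[of "5 * k - 2"]
    by (simp_all add: chi4_class_def add.commute[of 7])
qed

lemma chi4_class_support: "chi4_class r a \<noteq> 0 \<Longrightarrow> a mod 5 = r \<and> odd a"
  using chi4_even[of a] by (auto simp: chi4_class_def split: if_splits)

lemma minus_powi:
  fixes y :: real
  assumes "y > 0"
  shows "(- y) powi k = (if even k then 1 else - 1) * y powr real_of_int k"
  using assms by (simp add: power_int_minus_left powr_real_of_int')

text \<open>The terms k = n and k = -1 - n have opposite signs and exponents of q that differ by an
  integer, so each pair collapses to one term of the series at index 0, where \<open>qprod\<close>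
  is empty.\<close>

lemma theta_chi4_class_hw:
  assumes q: "0 < q" "q < 1"
  shows "theta (chi4_class 1) (q powr (1/40)) = q powr (1/40) * (\<Sum>r. hw2 q 0 r)"
    and "theta (chi4_class 2) (q powr (1/40)) = q powr (9/40) * (\<Sum>r. hw1 q 0 r)"
proof -
  define x where "x = q powr (1/40)"
  have x: "0 < x" "x < 1" using q by (auto simp: x_def powr01_less_one)
  have xp: "x powr t = q powr (t / 40)" for t by (simp add: x_def powr_powr)
  note prog = has_sum_theta_progression[OF x theta_weight_bound(1)[OF abs_chi4_class_le]]
  have "((\<lambda>k. chi4_class 1 (10 * k + 1) * x powr (real_of_int (10 * k + 1))\<^sup>2) has_sum theta (chi4_class 1) x) UNIV"
    by (rule prog) (simp, drule chi4_class_support, presburger)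
  from has_sum_int_split'[OF this]
  have "(\<lambda>n. chi4_class 1 (10 * int n + 1) * x powr (real_of_int (10 * int n + 1))\<^sup>2 +
      chi4_class 1 (10 * (- 1 - int n) + 1) * x powr (real_of_int (10 * (- 1 - int n) + 1))\<^sup>2) sums theta (chi4_class 1) x" .
  also have "(\<lambda>n. chi4_class 1 (10 * int n + 1) * x powr (real_of_int (10 * int n + 1))\<^sup>2 +
      chi4_class 1 (10 * (- 1 - int n) + 1) * x powr (real_of_int (10 * (- 1 - int n) + 1))\<^sup>2) =
      (\<lambda>n. q powr (1/40) * hw2 q 0 n)"
  proof
    fix n
    have c: "chi4_class 1 (10 * int n + 1) = (- 1) ^ n" "chi4_class 1 (10 * (- 1 - int n) + 1) = - ((- 1) ^ n)"
      unfolding chi4_class_progression by (simp_all add: minus_one_power_iff)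
    have "(real_of_int (10 * int n + 1))\<^sup>2 / 40 = 1/40 + (real (hw_exponent n))"
      by (simp add: real_hw_exponent power2_eq_square field_simps)
    hence e1: "x powr (real_of_int (10 * int n + 1))\<^sup>2 = q powr (1/40) * q ^ hw_exponent n"
      unfolding xp by (simp only: powr_add powr_realpow[OF q(1)])
    have "(real_of_int (10 * (- 1 - int n) + 1))\<^sup>2 / 40 = 1/40 + (real (hw_exponent n) + real (2 + 4 * n))"
      by (simp add: real_hw_exponent power2_eq_square field_simps)
    hence e2: "x powr (real_of_int (10 * (- 1 - int n) + 1))\<^sup>2 = q powr (1/40) * (q ^ hw_exponent n * q ^ (2 + 4 * n))"
      unfolding xp by (simp only: powr_add powr_realpow[OF q(1)])
    show "chi4_class 1 (10 * int n + 1) * x powr (real_of_int (10 * int n + 1))\<^sup>2 +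
      chi4_class 1 (10 * (- 1 - int n) + 1) * x powr (real_of_int (10 * (- 1 - int n) + 1))\<^sup>2 = q powr (1/40) * hw2 q 0 n"
      unfolding c e1 e2 hw2_def qprod_def by (simp add: algebra_simps)
  qed
  finally show "theta (chi4_class 1) (q powr (1/40)) = q powr (1/40) * (\<Sum>r. hw2 q 0 r)"
    unfolding x_def suminf_mult[OF summable_hw(2)[OF q], symmetric] by (rule sums_unique)
  have "((\<lambda>k. chi4_class 2 (10 * k + 7) * x powr (real_of_int (10 * k + 7))\<^sup>2) has_sum theta (chi4_class 2) x) UNIV"
    by (rule prog) (simp, drule chi4_class_support, presburger)
  from has_sum_int_split'[OF this]
  have "(\<lambda>n. chi4_class 2 (10 * int n + 7) * x powr (real_of_int (10 * int n + 7))\<^sup>2 +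
      chi4_class 2 (10 * (- 1 - int n) + 7) * x powr (real_of_int (10 * (- 1 - int n) + 7))\<^sup>2) sums theta (chi4_class 2) x" .
  also have "(\<lambda>n. chi4_class 2 (10 * int n + 7) * x powr (real_of_int (10 * int n + 7))\<^sup>2 +
      chi4_class 2 (10 * (- 1 - int n) + 7) * x powr (real_of_int (10 * (- 1 - int n) + 7))\<^sup>2) =
      (\<lambda>n. q powr (9/40) * hw1 q 0 n)"
  proof
    fix n
    have c: "chi4_class 2 (10 * int n + 7) = - ((- 1) ^ n)" "chi4_class 2 (10 * (- 1 - int n) + 7) = (- 1) ^ n"
      unfolding chi4_class_progression by (simp_all add: minus_one_power_iff)
    \<comment> \<open>Here the roles are reversed: 10(-1 - n) + 7 = -(10n + 3) has the smaller
      square and gives the leading term of the pair.\<close>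
    have "(real_of_int (10 * (- 1 - int n) + 7))\<^sup>2 / 40 = 9/40 + (real (n + hw_exponent n))"
      by (simp add: real_hw_exponent power2_eq_square field_simps)
    hence e1: "x powr (real_of_int (10 * (- 1 - int n) + 7))\<^sup>2 = q powr (9/40) * q ^ (n + hw_exponent n)"
      unfolding xp by (simp only: powr_add powr_realpow[OF q(1)])
    have "(real_of_int (10 * int n + 7))\<^sup>2 / 40 = 9/40 + (real (n + hw_exponent n) + real (1 + 2 * n))"
      by (simp add: real_hw_exponent power2_eq_square field_simps)
    hence e2: "x powr (real_of_int (10 * int n + 7))\<^sup>2 = q powr (9/40) * (q ^ (n + hw_exponent n) * q ^ (1 + 2 * n))"
      unfolding xp by (simp only: powr_add powr_realpow[OF q(1)])
    show "chi4_class 2 (10 * int n + 7) * x powr (real_of_int (10 * int n + 7))\<^sup>2 +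
      chi4_class 2 (10 * (- 1 - int n) + 7) * x powr (real_of_int (10 * (- 1 - int n) + 7))\<^sup>2 = q powr (9/40) * hw1 q 0 n"
      unfolding c e1 e2 hw1_def qprod_def by (simp add: algebra_simps)
  qed
  finally show "theta (chi4_class 2) (q powr (1/40)) = q powr (9/40) * (\<Sum>r. hw1 q 0 r)"
    unfolding x_def suminf_mult[OF summable_hw(1)[OF q], symmetric] by (rule sums_unique)
qed

lemma theta_chi4_class_pos:
  assumes q: "0 < q" "q < 1"
  shows "theta (chi4_class 1) (q powr (1/40)) > 0" "theta (chi4_class 2) (q powr (1/40)) > 0"
  using q suminf_hw2_pos[OF q] by (simp_all add: theta_chi4_class_hw suminf_hw1)

lemma rogers_ramanujan_eq_theta:
  assumes q: "0 < q" "q < 1"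
  shows "rogers_ramanujan q = theta (chi4_class 2) (q powr (1/40)) / theta (chi4_class 1) (q powr (1/40))"
proof -
  \<comment> \<open>The ratio of the leading powers of the two theta series is the prefactor q^(1/5)
    of R(q).\<close>
  have "q powr (9/40) = q powr (1/5) * q powr (1/40)"
    by (simp add: powr_add [symmetric])
  thus ?thesis
    using q by (simp add: theta_chi4_class_hw[OF q] rogers_ramanujan_eq_quotient[OF q])
qed

section \<open>Product formulas for the theta series\<close>

lemma theta_chi4_class_jacobi:
  assumes q: "0 < q" "q < 1"
  shows "theta (chi4_class 1) (q powr (1/40)) = q powr (1/40) *
      (\<Sum>\<^sub>\<infinity>k. (q ^ 5) powr (real_of_int k * (real_of_int k - 1) / 2) * (- (q ^ 3)) powi k)"
    and "theta (chi4_class 2) (q powr (1/40)) = q powr (9/40) *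
      (\<Sum>\<^sub>\<infinity>k. (q ^ 5) powr (real_of_int k * (real_of_int k - 1) / 2) * (- q) powi k)"
proof -
  define x where "x = q powr (1/40)"
  have x: "0 < x" "x < 1" using q by (auto simp: x_def powr01_less_one)
  have xp: "x powr t = q powr (t / 40)" for t by (simp add: x_def powr_powr)
  have q5: "(q ^ 5) powr t = q powr (5 * t)" and q3: "(q ^ 3) powr t = q powr (3 * t)" for t
    using q powr_powr[of q 5 t] powr_powr[of q 3 t] by simp_all
  note prog = has_sum_theta_progression[OF x theta_weight_bound(1)[OF abs_chi4_class_le]]
  have 1: "chi4_class 1 (10 * k + 1) * x powr (real_of_int (10 * k + 1))\<^sup>2 =
    q powr (1/40) * ((q ^ 5) powr (real_of_int k * (real_of_int k - 1) / 2) * (- (q ^ 3)) powi k)" for k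
  proof -
    note chi4_class_progression(1)[of k]
    \<comment> \<open>The remainder 3k beside 5k(k-1)/2, together with the sign of the character,
      dictates w = -q^3 at base q^5.\<close>
    moreover have "(real_of_int (10 * k + 1))\<^sup>2 / 40 = 1/40 + (5 * (real_of_int k * (real_of_int k - 1) / 2) + 3 * real_of_int k)"
      by (simp add: power2_eq_square field_simps)
    ultimately show ?thesis
      using q unfolding xp q5 by (simp only: minus_powi zero_less_power q3 powr_add mult_ac)
  qed
  have "((\<lambda>k. chi4_class 1 (10 * k + 1) * x powr (real_of_int (10 * k + 1))\<^sup>2) has_sum theta (chi4_class 1) x) UNIV"
    by (rule prog) (simp, drule chi4_class_support, presburger)
  thus "theta (chi4_class 1) (q powr (1/40)) = q powr (1/40) *
      (\<Sum>\<^sub>\<infinity>k. (q ^ 5) powr (real_of_int k * (real_of_int k - 1) / 2) * (- (q ^ 3)) powi k)"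
    unfolding 1 x_def [symmetric] by (simp add: has_sum_iff infsum_cmult_right')
  have 2: "chi4_class 2 (10 * k + - 3) * x powr (real_of_int (10 * k + - 3))\<^sup>2 =
    q powr (9/40) * ((q ^ 5) powr (real_of_int k * (real_of_int k - 1) / 2) * (- q) powi k)" for k
  proof -
    note chi4_class_progression(3)[of k]
    moreover have "(real_of_int (10 * k + - 3))\<^sup>2 / 40 = 9/40 + (5 * (real_of_int k * (real_of_int k - 1) / 2) + real_of_int k)"
      by (simp add: power2_eq_square field_simps)
    ultimately show ?thesis
      using q unfolding xp q5 by (simp only: minus_powi powr_add mult_ac)
  qed
  have "((\<lambda>k. chi4_class 2 (10 * k + - 3) * x powr (real_of_int (10 * k + - 3))\<^sup>2) has_sum theta (chi4_class 2) x) UNIV"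
    by (rule prog) (simp, drule chi4_class_support, presburger)
  thus "theta (chi4_class 2) (q powr (1/40)) = q powr (9/40) *
      (\<Sum>\<^sub>\<infinity>k. (q ^ 5) powr (real_of_int k * (real_of_int k - 1) / 2) * (- q) powi k)"
    unfolding 2 x_def [symmetric] by (simp add: has_sum_iff infsum_cmult_right')
qed

text \<open>Exponents sorted by residue modulo 5: w = -q^3 accounts for 3 and 2, w = -q for 1 and 4,
  and the last product for 0.\<close>

lemma prod_mod_5:
  fixes q :: real
  assumes "q > 0"
  shows "(\<Prod>n<N. (1 + - (q ^ 3) * (q ^ 5) ^ n) * (1 + (q ^ 5) ^ Suc n / - (q ^ 3))) *
      (\<Prod>n<N. (1 + - q * (q ^ 5) ^ n) * (1 + (q ^ 5) ^ Suc n / - q)) *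
      (\<Prod>n<N. 1 - (q ^ 5) ^ Suc n) = (\<Prod>n<5 * N. 1 - q ^ Suc n)"
proof (induction N)
  case (Suc N)
  define z where "z = (q ^ 5) ^ N"
  define m where "m = 5 * N"
  have z: "q ^ m = z" by (simp add: z_def m_def power_mult)
  have "5 * Suc N = Suc (Suc (Suc (Suc (Suc m))))" by (simp add: m_def)
  hence "(\<Prod>n<5 * Suc N. 1 - q ^ Suc n) = (\<Prod>n<m. 1 - q ^ Suc n) *
      ((1 - q * z) * (1 - q ^ 2 * z) * (1 - q ^ 3 * z) * (1 - q ^ 4 * z) * (1 - q ^ 5 * z))"
    by (simp add: z mult.assoc eval_nat_numeral)
  moreover have "1 + - (q ^ 3) * z = 1 - q ^ 3 * z" "1 + q ^ 5 * z / - (q ^ 3) = 1 - q ^ 2 * z"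
     "1 + - q * z = 1 - q * z" "1 + q ^ 5 * z / - q = 1 - q ^ 4 * z"
    using assms by (simp_all add: field_simps eval_nat_numeral)
  ultimately show ?case
    unfolding prod.lessThan_Suc power_Suc[of "q ^ 5" N] z_def [symmetric] m_def Suc [symmetric]
    by (simp only: mult_ac)
qed simp

lemma theta_chi4_class_product:
  assumes q: "0 < q" "q < 1"
  shows "theta (chi4_class 2) (q powr (1/40)) * theta (chi4_class 1) (q powr (1/40)) =
    q powr (1/4) * (ramanujan_f (- q) * ramanujan_f (- (q ^ 5)))"
proof -
  have p: "0 < q ^ 5" "q ^ 5 < 1" using q by (auto simp: power_less_one_iff)
  define F5 where "F5 = ramanujan_f (- (q ^ 5))"
  have F5: "F5 > 0" unfolding F5_def by (rule ramanujan_f_pos[OF p])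
  define A where "A w = (\<Sum>\<^sub>\<infinity>k. (q ^ 5) powr (real_of_int k * (real_of_int k - 1) / 2) * w powi k)" for w
  have "(\<lambda>N. (\<Prod>n<N. (1 + - (q ^ 3) * (q ^ 5) ^ n) * (1 + (q ^ 5) ^ Suc n / - (q ^ 3))) *
      (\<Prod>n<N. (1 + - q * (q ^ 5) ^ n) * (1 + (q ^ 5) ^ Suc n / - q)) *
      (\<Prod>n<N. 1 - (q ^ 5) ^ Suc n)) \<longlonglongrightarrow> A (- (q ^ 3)) / F5 * (A (- q) / F5) * F5"
    unfolding A_def F5_def using q
    by (intro tendsto_mult jacobi_triple_product p euler_product_LIMSEQ) auto
  moreover have "(\<lambda>N. \<Prod>n<5 * N. 1 - q ^ Suc n) \<longlonglongrightarrow> ramanujan_f (- q)"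
    by (rule filterlim_compose[OF euler_product_LIMSEQ[OF q]]) (simp add: mult_nat_left_at_top)
  ultimately have "A (- (q ^ 3)) / F5 * (A (- q) / F5) * F5 = ramanujan_f (- q)"
    unfolding prod_mod_5[OF q(1)] by (rule LIMSEQ_unique)
  hence "A (- (q ^ 3)) * A (- q) = ramanujan_f (- q) * F5"
    using F5 by (simp add: field_simps)
  moreover have "q powr (9/40) * q powr (1/40) = q powr (1/4)"
    by (simp add: powr_add [symmetric])
  ultimately show ?thesis
    unfolding theta_chi4_class_jacobi[OF q] A_def [symmetric] F5_def [symmetric] by (simp add: mult_ac)
qed

lemma theta_weighted_chi4:
  assumes q: "0 < q" "q < 1"
  shows "theta (\<lambda>a. real_of_int a * chi4 a) (q powr (1/8)) = 2 * q powr (1/8) * ramanujan_f (- q) ^ 3"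
proof -
  define x where "x = q powr (1/8)"
  have x: "0 < x" "x < 1" using q by (auto simp: x_def powr01_less_one)
  have xp: "x powr t = q powr (t / 8)" for t by (simp add: x_def powr_powr)
  define K where "K = theta (\<lambda>a. real_of_int a * chi4 a) x"
  have "theta chi4 x = (\<Sum>\<^sub>\<infinity>a. - (chi4 a * x powr (real_of_int a)\<^sup>2))"
    unfolding theta_def
    by (rule infsum_reindex_bij_witness[where i = uminus and j = uminus]) (auto simp: chi4_minus)
  hence "theta chi4 x = 0" by (simp add: theta_def infsum_uminus)
  moreover have "((\<lambda>k. chi4 (2 * k + - 1) * x powr (real_of_int (2 * k + - 1))\<^sup>2) has_sum theta chi4 x) UNIV"
    by (rule has_sum_theta_progression[OF x theta_weight_bound(1)[OF abs_chi4_le]])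
      (simp, use chi4_even in fastforce)
  moreover have "((\<lambda>k. real_of_int (2 * k + - 1) * chi4 (2 * k + - 1) * x powr (real_of_int (2 * k + - 1))\<^sup>2) has_sum K) UNIV"
    unfolding K_def
    by (rule has_sum_theta_progression[OF x theta_weight_bound(2)[OF abs_chi4_le]])
      (simp, use chi4_even in fastforce)
  \<comment> \<open>The cube identity has weight k = ((2k - 1) + 1)/2. Adding the unweighted series,
    which is zero by oddness, converts the weight 2k - 1 into this one.\<close>
  ultimately have "((\<lambda>k. 1 / 2 * (chi4 (2 * k + - 1) * x powr (real_of_int (2 * k + - 1))\<^sup>2 +
      real_of_int (2 * k + - 1) * chi4 (2 * k + - 1) * x powr (real_of_int (2 * k + - 1))\<^sup>2)) has_sum 1 / 2 * (0 + K)) UNIV"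
    by (intro has_sum_cmult_right has_sum_add) simp_all
  also have "(\<lambda>k. 1 / 2 * (chi4 (2 * k + - 1) * x powr (real_of_int (2 * k + - 1))\<^sup>2 +
      real_of_int (2 * k + - 1) * chi4 (2 * k + - 1) * x powr (real_of_int (2 * k + - 1))\<^sup>2)) =
      (\<lambda>k. - (q powr (1/8)) * (q powr (real_of_int k * (real_of_int k - 1) / 2) * (real_of_int k * (- 1) powi k)))"
  proof
    fix k
    have c: "chi4 (2 * k + - 1) = - ((- 1) powi k)"
      using chi4_odd[of "k - 1"] minus_powi[of 1 k] by auto
    have "(real_of_int (2 * k + - 1))\<^sup>2 / 8 = 1/8 + real_of_int k * (real_of_int k - 1) / 2"
      by (simp add: power2_eq_square field_simps)
    hence e: "x powr (real_of_int (2 * k + - 1))\<^sup>2 = q powr (1/8) * q powr (real_of_int k * (real_of_int k - 1) / 2)"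
      unfolding xp by (simp only: powr_add)
    show "1 / 2 * (chi4 (2 * k + - 1) * x powr (real_of_int (2 * k + - 1))\<^sup>2 +
      real_of_int (2 * k + - 1) * chi4 (2 * k + - 1) * x powr (real_of_int (2 * k + - 1))\<^sup>2) =
      - (q powr (1/8)) * (q powr (real_of_int k * (real_of_int k - 1) / 2) * (real_of_int k * (- 1) powi k))"
      unfolding c e by (simp add: algebra_simps)
  qed
  finally have "(\<Sum>\<^sub>\<infinity>k. - (q powr (1/8)) * (q powr (real_of_int k * (real_of_int k - 1) / 2) * (real_of_int k * (- 1) powi k))) = 1 / 2 * (0 + K)"
    by (rule infsumI)
  hence "K / 2 = - (q powr (1/8)) * - (ramanujan_f (- q) ^ 3)"
    unfolding infsum_cmult_right' jacobi_cube[OF q] by simp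
  thus ?thesis by (simp add: K_def x_def)
qed

section \<open>The substitution\<close>

lemma rogers_ramanujan_pos:
  assumes q: "0 < q" "q < 1"
  shows "rogers_ramanujan q > 0"
  unfolding rogers_ramanujan_eq_theta[OF q] by (intro divide_pos_pos theta_chi4_class_pos q)

lemma rr_y_eq:
  assumes q: "0 < q" "q < 1"
  shows "rr_y q = ramanujan_f (- (q powr (1/5))) / (q powr (1/5) * ramanujan_f (- (q ^ 5)))"
proof -
  define t where "t = q powr (1/5)"
  have t: "0 < t" "t < 1" using q by (auto simp: t_def powr01_less_one)
  \<comment> \<open>The quadratic identity is used at base \<open>t\<close>, where it leads back to
    theta series at base \<open>q\<close>. The common factor f(-q) of the two product formulas then
    cancels.\<close>
  have t5: "t ^ 5 = q" using q by (simp add: t_def powr_realpow [symmetric] powr_powr)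
  define x where "x = t powr (1/40)"
  have x: "0 < x" "x < 1" using t by (auto simp: x_def powr01_less_one)
  have x5: "x ^ 5 = q powr (1/40)"
    using q by (simp add: x_def t_def powr_realpow [symmetric] powr_powr)
  define A B where "A = theta (chi4_class 1) (q powr (1/40))" and "B = theta (chi4_class 2) (q powr (1/40))"
  have AB: "A > 0" "B > 0" unfolding A_def B_def by (intro theta_chi4_class_pos q)+
  have "A\<^sup>2 - A * B - B\<^sup>2 = t powr (1/4) * (ramanujan_f (- t) * ramanujan_f (- q))"
    using theta_chi4_class_quadratic[OF x] theta_chi4_class_product[OF t]
    unfolding x5 t5 x_def [symmetric] A_def [symmetric] B_def [symmetric] by simp
  moreover have "B * A = q powr (1/4) * (ramanujan_f (- q) * ramanujan_f (- (q ^ 5)))"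
    unfolding A_def B_def by (rule theta_chi4_class_product[OF q])
  moreover have "q powr (1/4) = t powr (1/4) * t"
    by (simp add: t_def powr_powr powr_add [symmetric])
  moreover have "rr_y q = (A\<^sup>2 - A * B - B\<^sup>2) / (B * A)"
    unfolding rr_y_def rogers_ramanujan_eq_theta[OF q] A_def [symmetric] B_def [symmetric]
    using AB by (simp add: field_simps power2_eq_square)
  ultimately show ?thesis
    using ramanujan_f_pos[OF q] t unfolding t_def [symmetric] by simp
qed

lemma rr_y_pos:
  assumes q: "0 < q" "q < 1"
  shows "rr_y q > 0"
proof -
  have "0 < q powr (1/5)" "q powr (1/5) < 1" "0 < q ^ 5" "q ^ 5 < 1"
    using q by (auto simp: powr01_less_one power_less_one_iff)
  thus ?thesis unfolding rr_y_eq[OF q] by (intro divide_pos_pos mult_pos_pos ramanujan_f_pos)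
qed

lemma sqrt_rr_y:
  assumes q: "0 < q" "q < 1"
  shows "sqrt (5 + 2 * rr_y q + (rr_y q)\<^sup>2) = 1 / rogers_ramanujan q + rogers_ramanujan q"
proof -
  define r where "r = rogers_ramanujan q"
  have r: "r > 0" unfolding r_def by (rule rogers_ramanujan_pos[OF q])
  \<comment> \<open>The left side is 4 + (1 + y)^2 with 1 + y = 1/r - r.\<close>
  have "5 + 2 * rr_y q + (rr_y q)\<^sup>2 = (1 / r + r)\<^sup>2"
    using r by (simp add: rr_y_def r_def [symmetric] field_simps power2_eq_square)
  thus ?thesis using r by (simp add: r_def [symmetric])
qed

text \<open>Written with theta series rather than Euler products, whose continuity is then not needed.\<close>
definition rr_y_deriv :: "real \<Rightarrow> real" where
  "rr_y_deriv q = - ((theta (\<lambda>a. real_of_int a * chi4 a) (q powr (1/8)))\<^sup>2 /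
     (20 * q * (theta (chi4_class 2) (q powr (1/40)) * theta (chi4_class 1) (q powr (1/40)))))
     * (1 / rogers_ramanujan q + rogers_ramanujan q)"

lemma has_real_derivative_theta_powr:
  assumes q: "0 < q" "q < 1" and "e > 0" and c: "\<And>a. \<bar>c a\<bar> \<le> 1 + (real_of_int a)\<^sup>2"
  shows "((\<lambda>q. theta c (q powr e)) has_real_derivative
    e * theta (\<lambda>a. (real_of_int a)\<^sup>2 * c a) (q powr e) / q) (at q)"
proof -
  have x: "0 < q powr e" "q powr e < 1" using assms by (auto simp: powr01_less_one)
  have "((\<lambda>q. q powr e) has_real_derivative e * q powr (e - 1)) (at q)"
    using q by (auto intro!: derivative_eq_intros)
  from DERIV_chain2[OF has_real_derivative_theta[OF x c] this] show ?thesis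
    using q by (simp add: powr_diff field_simps)
qed

lemma rr_y_has_real_derivative:
  assumes q: "0 < q" "q < 1"
  shows "(rr_y has_real_derivative rr_y_deriv q) (at q)"
proof -
  define x where "x = q powr (1/40)"
  have x: "0 < x" "x < 1" using q by (auto simp: x_def powr01_less_one)
  have x5: "x ^ 5 = q powr (1/8)"
    using q by (simp add: x_def powr_realpow [symmetric] powr_powr)
  define T T' where "T = (\<lambda>r q. theta (chi4_class r) (q powr (1/40)))"
    and "T' = (\<lambda>r. theta (\<lambda>a. (real_of_int a)\<^sup>2 * chi4_class r a) x)"
  define K where "K = theta (\<lambda>a. real_of_int a * chi4 a) (q powr (1/8))"
  have "(T r has_real_derivative (1/40) * T' r / q) (at q)" for r
    unfolding T_def T'_def x_def
    by (rule has_real_derivative_theta_powr[OF q])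
      (auto intro: order_trans[OF abs_chi4_class_le])
  note deriv = this
  have pos: "T 1 q > 0" "T 2 q > 0"
    unfolding T_def by (intro theta_chi4_class_pos q)+
  \<comment> \<open>Both quotient-rule numerators below are multiples of this Wronskian; the 1/40 of
    the chain rule and the 2 here combine to the 20 in \<open>rr_y_deriv\<close>.\<close>
  have W: "T' 2 * T 1 q - T 2 q * T' 1 = 2 * K\<^sup>2"
    using theta_chi4_class_wronskian[OF x] unfolding x5 unfolding T_def T'_def K_def x_def by simp
  have "((\<lambda>q. T 1 q / T 2 q - 1 - T 2 q / T 1 q) has_real_derivative
      ((1/40) * T' 1 / q * T 2 q - T 1 q * ((1/40) * T' 2 / q)) / (T 2 q * T 2 q)
      - ((1/40) * T' 2 / q * T 1 q - T 2 q * ((1/40) * T' 1 / q)) / (T 1 q * T 1 q)) (at q)"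
    using pos by (auto intro!: derivative_eq_intros deriv)
  also have "((1/40) * T' 1 / q * T 2 q - T 1 q * ((1/40) * T' 2 / q)) / (T 2 q * T 2 q)
      - ((1/40) * T' 2 / q * T 1 q - T 2 q * ((1/40) * T' 1 / q)) / (T 1 q * T 1 q)
      = - ((T' 2 * T 1 q - T 2 q * T' 1) / (40 * q * (T 2 q * T 1 q))) * (T 1 q / T 2 q + T 2 q / T 1 q)"
    using pos q by (simp add: divide_simps) (simp add: algebra_simps)
  also have "\<dots> = rr_y_deriv q"
    unfolding W by (simp add: rr_y_deriv_def rogers_ramanujan_eq_theta[OF q] T_def K_def)
  finally show ?thesis
  proof (rule has_field_derivative_transform_within_open[of _ _ _ "{0<..<1}"])
    show "T 1 q / T 2 q - 1 - T 2 q / T 1 q = rr_y q" if "q \<in> {0<..<1}" for q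
      using that by (simp add: rr_y_def rogers_ramanujan_eq_theta T_def)
  qed (use q in auto)
qed

text \<open>The square of 2 q^(1/8) f(-q)^3 divided by q^(1/4) f(-q) f(-q^5) leaves 4 f(-q)^5 /
  f(-q^5), and the sum 1/R + R is the square root.\<close>

lemma rr_y_deriv_eq:
  assumes q: "0 < q" "q < 1"
  shows "rr_y_deriv q = - (ramanujan_f (- q) ^ 5 / (5 * q * ramanujan_f (- (q ^ 5)))) *
    sqrt (5 + 2 * rr_y q + (rr_y q)\<^sup>2)"
proof -
  have p: "0 < q ^ 5" "q ^ 5 < 1" using q by (auto simp: power_less_one_iff)
  have "(2 * q powr (1/8) * ramanujan_f (- q) ^ 3)\<^sup>2 = 4 * q powr (1/4) * ramanujan_f (- q) ^ 6"
  proof -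
    have "(q powr (1/8))\<^sup>2 = q powr (1/4)" by (simp add: power2_eq_square powr_add [symmetric])
    thus ?thesis by (simp add: power_mult_distrib power_mult [symmetric])
  qed
  thus ?thesis
    unfolding rr_y_deriv_def sqrt_rr_y[OF q] theta_weighted_chi4[OF q] theta_chi4_class_product[OF q]
    using ramanujan_f_pos[OF q] ramanujan_f_pos[OF p] q
    by (simp add: field_simps eval_nat_numeral)
qed

lemma continuous_on_rr_y_deriv: "continuous_on {0<..<1} rr_y_deriv"
proof -
  have theta: "continuous_on {0<..<1} (\<lambda>q. theta c (q powr e))"
    if "e > 0" "\<And>a. \<bar>c a\<bar> \<le> 1 + (real_of_int a)\<^sup>2" for c e
    by (intro continuous_at_imp_continuous_on ballI DERIV_isCont[OF has_real_derivative_theta_powr])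
      (use that in auto)
  have c: "\<bar>chi4_class r a\<bar> \<le> 1 + (real_of_int a)\<^sup>2" for r a
    by (rule order_trans[OF abs_chi4_class_le]) simp
  have K: "\<bar>real_of_int a * chi4 a\<bar> \<le> 1 + (real_of_int a)\<^sup>2" for a
  proof -
    have "\<bar>real_of_int a * chi4 a\<bar> \<le> \<bar>real_of_int a\<bar>"
      using mult_left_mono[OF abs_chi4_le[of a] abs_ge_zero[of "real_of_int a"]] by (simp add: abs_mult)
    also have "\<dots> \<le> 1 + (real_of_int a)\<^sup>2"
      using zero_le_power2[of "\<bar>real_of_int a\<bar> - 1"] by (simp add: power2_diff)
    finally show ?thesis .
  qed
  have nz: "theta (chi4_class 1) (q powr (1/40)) \<noteq> 0" "theta (chi4_class 2) (q powr (1/40)) \<noteq> 0"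
    if "q \<in> {0<..<1}" for q
    using that theta_chi4_class_pos[of q] by auto
  have R: "continuous_on {0<..<1} rogers_ramanujan"
  proof (subst continuous_on_cong[OF refl])
    show "rogers_ramanujan q = theta (chi4_class 2) (q powr (1/40)) / theta (chi4_class 1) (q powr (1/40))"
      if "q \<in> {0<..<1}" for q
      using that by (simp add: rogers_ramanujan_eq_theta)
    show "continuous_on {0<..<1} (\<lambda>q. theta (chi4_class 2) (q powr (1/40)) / theta (chi4_class 1) (q powr (1/40)))"
      by (intro continuous_on_divide theta c) (use nz in auto)
  qed
  have "rogers_ramanujan q \<noteq> 0" if "q \<in> {0<..<1}" for q
    using that rogers_ramanujan_pos[of q] by auto
  thus ?thesis
    unfolding rr_y_deriv_def
    by (intro continuous_intros theta c K R ballI) (use nz in auto)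
qed

section \<open>Change of variables in the integral\<close>

definition rr_integrand :: "real \<Rightarrow> real \<Rightarrow> real" where
  "rr_integrand k x = x powr (k - 1) / sqrt (5 + 2 * x + x ^ 2)"

lemma eta_quotient_eq_rr_integrand:
  assumes q: "0 < q" "q < 1"
  shows "(ramanujan_f (- (q powr (1/5))) / (q powr (1/5) * ramanujan_f (- (q ^ 5)))) powr k
              * q powr (- 4/5) * (ramanujan_f (- q) ^ 5 / ramanujan_f (- (q powr (1/5))))
      = - 5 * (rr_y_deriv q *\<^sub>R rr_integrand k (rr_y q))"
proof -
  define t where "t = q powr (1/5)"
  have t: "0 < t" "t < 1" and p: "0 < q ^ 5" "q ^ 5 < 1"
    using q by (auto simp: t_def powr01_less_one power_less_one_iff)
  define y F F5 Ft where "y = rr_y q" and "F = ramanujan_f (- q)" and "F5 = ramanujan_f (- (q ^ 5))"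
    and "Ft = ramanujan_f (- t)"
  have pos: "y > 0" "F > 0" "F5 > 0" "Ft > 0"
    unfolding y_def F_def F5_def Ft_def by (intro rr_y_pos ramanujan_f_pos q t p)+
  have y: "y = Ft / (t * F5)"
    using rr_y_eq[OF q] by (simp add: y_def Ft_def F5_def t_def)
  hence Ft: "Ft = y * t * F5" using t pos by simp
  define s where "s = sqrt (5 + 2 * y + y\<^sup>2)"
  have s: "s > 0" unfolding s_def using pos(1) by (simp add: add_pos_pos)
  \<comment> \<open>Once q^(-4/5) = t/q and y^k = y * y^(k-1) are in place, f(-t) = y t f(-q^5)
    cancels both \<open>t\<close> and the extra factor y.\<close>
  have "q * q powr (- 4/5) = t"
    using q powr_mult_base[of q "- 4/5"] by (simp add: t_def)
  hence q4: "q powr (- 4/5) = t / q" using q by (simp add: field_simps)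
  define Y where "Y = y powr (k - 1)"
  have yk: "y powr k = y * Y"
    using powr_mult_base[of y "k - 1"] pos(1) by (simp add: Y_def)
  have "(Ft / (t * F5)) powr k * q powr (- 4/5) * (F ^ 5 / Ft) = y * Y * (t / q) * (F ^ 5 / (y * t * F5))"
    unfolding y [symmetric] q4 yk by (simp only: Ft)
  also have "\<dots> = - 5 * (- (F ^ 5 / (5 * q * F5)) * s * (Y / s))"
    using s pos t q by simp
  also have "\<dots> = - 5 * (rr_y_deriv q *\<^sub>R rr_integrand k (rr_y q))"
    unfolding rr_y_deriv_eq[OF q] rr_integrand_def y_def [symmetric] s_def [symmetric] F_def [symmetric]
      F5_def [symmetric] Y_def [symmetric] real_scaleR_def ..
  finally show ?thesis
    by (simp only: t_def F_def F5_def Ft_def)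
qed

lemma continuous_on_rr_integrand: "continuous_on {0<..} (rr_integrand k)"
proof -
  have "sqrt (5 + 2 * x + x\<^sup>2) \<noteq> 0" if "x \<in> {0<..}" for x :: real
  proof -
    have "5 + 2 * x + x\<^sup>2 > 0" using that by (intro add_pos_pos) auto
    thus ?thesis by simp
  qed
  moreover have "continuous_on {0<..} (\<lambda>x. x powr (k - 1))"
    by (intro continuous_on_powr continuous_on_id continuous_on_const) auto
  moreover have "continuous_on {0<..} (\<lambda>x :: real. sqrt (5 + 2 * x + x\<^sup>2))"
    by (intro continuous_intros)
  ultimately have "continuous_on {0<..} (\<lambda>x. x powr (k - 1) / sqrt (5 + 2 * x + x\<^sup>2))"
    by (intro continuous_on_divide ballI)
  thus ?thesis by (simp add: rr_integrand_def [abs_def])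
qed

text \<open>The derivative of y is negative, so the limits on the right come in reversed order; the
  oriented integral accounts for the sign.\<close>

lemma integral_substitution_rr_y:
  assumes "0 < a" "a \<le> b" "b < 1"
  shows "(LBINT q=ereal a..ereal b. rr_y_deriv q *\<^sub>R rr_integrand k (rr_y q)) =
    (LBINT x=ereal (rr_y a)..ereal (rr_y b). rr_integrand k x)"
proof (rule interval_integral_substitution_finite[where g = rr_y and g' = rr_y_deriv and f = "rr_integrand k"])
  show "(rr_y has_real_derivative rr_y_deriv q) (at q within {a..b})" if "a \<le> q" "q \<le> b" for q
    by (rule has_field_derivative_at_within, rule rr_y_has_real_derivative) (use that assms in auto)
  show "continuous_on {a..b} rr_y_deriv"
    by (rule continuous_on_subset[OF continuous_on_rr_y_deriv]) (use assms in auto)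
  have "rr_y ` {a..b} \<subseteq> {0<..}"
    using assms by (auto intro!: rr_y_pos)
  thus "continuous_on (rr_y ` {a..b}) (rr_integrand k)"
    by (rule continuous_on_subset[OF continuous_on_rr_integrand])
qed (rule assms)

lemma eta_quotient_integral:
  fixes k :: real
  assumes "0 < a" "a \<le> b" "b < 1"
  shows "(LBINT q=ereal a..ereal b.
            (ramanujan_f (- (q powr (1/5))) / (q powr (1/5) * ramanujan_f (- (q ^ 5)))) powr k
              * q powr (- 4/5) * (ramanujan_f (- q) ^ 5 / ramanujan_f (- (q powr (1/5)))))
       = - 5 * (LBINT x=ereal (rr_y a)..ereal (rr_y b). rr_integrand k x)"
  unfolding integral_substitution_rr_y[OF assms, symmetric] interval_lebesgue_integral_mult_right [symmetric]
proof (rule interval_integral_cong)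
  fix q assume "q \<in> einterval (min (ereal a) (ereal b)) (max (ereal a) (ereal b))"
  hence "0 < q" "q < 1" using assms by (auto simp: einterval_iff)
  thus "(ramanujan_f (- (q powr (1/5))) / (q powr (1/5) * ramanujan_f (- (q ^ 5)))) powr k
              * q powr (- 4/5) * (ramanujan_f (- q) ^ 5 / ramanujan_f (- (q powr (1/5))))
      = - 5 * (rr_y_deriv q *\<^sub>R rr_integrand k (rr_y q))"
    by (rule eta_quotient_eq_rr_integrand)
qed

theorem theorem8:
  fixes k a b :: real
  assumes "0 < a" "a < 1" "0 < b" "b < 1"
  shows "(LBINT q=ereal a..ereal b.
            (ramanujan_f (- (q powr (1/5))) / (q powr (1/5) * ramanujan_f (- (q ^ 5)))) powr k
              * q powr (- 4/5) * (ramanujan_f (- q) ^ 5 / ramanujan_f (- (q powr (1/5)))))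
       = - 5 * (LBINT x=ereal (rr_y a)..ereal (rr_y b).
            x powr (k - 1) / sqrt (5 + 2 * x + x ^ 2))"
proof (cases "a \<le> b")
  case True
  thus ?thesis
    using eta_quotient_integral[of a b k] assms by (simp only: rr_integrand_def)
next
  case False
  \<comment> \<open>For b < a both oriented integrals change sign when their limits are
    exchanged.\<close>
  have "interval_lebesgue_integral lborel (ereal a) (ereal b) f = - interval_lebesgue_integral lborel (ereal b) (ereal a) f"
    for a b and f :: "real \<Rightarrow> real"
    by (rule interval_integral_endpoints_reverse)
  note reverse = this[of a b] this[of "rr_y a" "rr_y b"]
  show ?thesis
    using eta_quotient_integral[of b a k] False assms
    unfolding reverse by (simp only: rr_integrand_def)
qed

end
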